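(* There is an absolute constant $C>0$ such that for every odd prime $p$, every integer $1\le k\le\frac{\log p}{\log\log p}$ and every $A\in\mathscr{A}(p)$ with $|A|=2k+1$, the total variation mixing time $t_1^{\mathrm{mix}}$ of the random walk on $\mathbb{Z}/p\mathbb{Z}$ driven by $\mu_A$ satisfies $$t_1^{\mathrm{mix}}\le C\,k\cdot\mathrm{diam}_{\mathrm{geom}}(\mathscr{C}(A,p))^2.$$
   Context: For a prime $p$, $\mathscr{A}(p)$ is the collection of sets $A\subset\mathbb{Z}/p\mathbb{Z}$ that are symmetric ($x\in A\iff-x\in A$), lazy ($0\in A$) and generating ($|A|>1$). $\mu_A$ is the uniform probability measure on $A$, $\mu_A^{*n}$ its $n$-fold convolution power, and $\mathbb{U}$ the uniform measure on $\mathbb{Z}/p\mathbb{Z}$. $\|\mu-\nu\|_{\mathrm{TV}}=\sup_S|\mu(S)-\nu(S)|$ and $t_1^{\mathrm{mix}}=\inf\{n:\|\mu_A^{*n}-\mathbb{U}\|_{\mathrm{TV}}\le\frac1e\}$. $\mathscr{C}(A,p)$ denotes the Cayley graph of $\mathbb{Z}/p\mathbb{Z}$ with respect to $A$. Writing $A=\{0,\pm a_1,\dots,\pm a_k\}$ with $\underline a=(a_1,\dots,a_k)$ containing one representative of each pair $\{x,-x\}\subset A\setminus\{0\}$, its geometric diameter is $$\mathrm{diam}_{\mathrm{geom}}(\mathscr{C}(A,p))=\max_{x\in\mathbb{Z}/p\mathbb{Z}}\ \min\left\{\|\underline n\|_2:\underline n\in\mathbb{Z}^k,\ \underline n\cdot\underline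 a\equiv x\bmod p\right\}.$$ *)

theory Defs
  imports
    "HOL-Number_Theory.Residues"
    "HOL-Analysis.L2_Norm"
    "HOL-Probability.Probability"
begin

text \<open>
  \<^const>\<open>residue_ring\<close> has carrier \<open>{0..p - 1}\<close> (as integers) with addition and
  multiplication modulo \<open>p\<close>. An explicit carrier is used, rather than a residue type,
  so that constants can be chosen before \<open>p\<close>.
\<close>

abbreviation Zmod :: "nat \<Rightarrow> int ring" where
  "Zmod p \<equiv> residue_ring (int p)"

definition sym_lazy_gen_sets :: "nat \<Rightarrow> int set set" where
  "sym_lazy_gen_sets p =
     {A. A \<subseteq> carrier (Zmod p)
       \<and> (\<forall>x\<in>carrier (Zmod p). x \<in> A \<longleftrightarrow> \<ominus>\<^bsub>Zmod p\<^esub> x \<in> A)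
       \<and> \<zero>\<^bsub>Zmod p\<^esub> \<in> A
       \<and> card A > 1}"

definition convolution_Zmod :: "nat \<Rightarrow> int pmf \<Rightarrow> int pmf \<Rightarrow> int pmf" where
  "convolution_Zmod p \<mu> \<nu> = map_pmf (\<lambda>(x, y). x \<oplus>\<^bsub>Zmod p\<^esub> y) (pair_pmf \<mu> \<nu>)"

primrec convolution_power_Zmod :: "nat \<Rightarrow> int pmf \<Rightarrow> nat \<Rightarrow> int pmf" where
  "convolution_power_Zmod p \<mu> 0 = return_pmf \<zero>\<^bsub>Zmod p\<^esub>"
| "convolution_power_Zmod p \<mu> (Suc n) = convolution_Zmod p \<mu> (convolution_power_Zmod p \<mu> n)"

definition tv_dist :: "'a pmf \<Rightarrow> 'a pmf \<Rightarrow> real" where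
  "tv_dist \<mu> \<nu> = (SUP S. \<bar>measure_pmf.prob \<mu> S - measure_pmf.prob \<nu> S\<bar>)"

text \<open>The infimum is taken in \<^typ>\<open>enat\<close>, so it would be \<open>\<infinity>\<close> if no \<open>n\<close> qualified.\<close>

definition mixing_time :: "nat \<Rightarrow> int set \<Rightarrow> enat" where
  "mixing_time p A =
     Inf (enat ` {n. tv_dist (convolution_power_Zmod p (pmf_of_set A) n)
                             (pmf_of_set (carrier (Zmod p))) \<le> 1 / exp 1})"

text \<open>
  Vectors of length \<open>k\<close> are functions on \<^typ>\<open>nat\<close> of which only the values below \<open>k\<close> matter.
\<close>

definition representative_vector :: "nat \<Rightarrow> int set \<Rightarrow> nat \<Rightarrow> (nat \<Rightarrow> int) \<Rightarrow> bool" where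
  "representative_vector p A k a \<longleftrightarrow>
     (\<forall>i<k. a i \<in> A - {\<zero>\<^bsub>Zmod p\<^esub>})
   \<and> (\<forall>x\<in>A - {\<zero>\<^bsub>Zmod p\<^esub>}. \<exists>!i. i < k \<and> a i \<in> {x, \<ominus>\<^bsub>Zmod p\<^esub> x})"

definition rep_lengths :: "nat \<Rightarrow> nat \<Rightarrow> (nat \<Rightarrow> int) \<Rightarrow> int \<Rightarrow> real set" where
  "rep_lengths p k a x =
     {L2_set (\<lambda>i. real_of_int (n i)) {..<k} | n. [(\<Sum>i<k. n i * a i) = x] (mod int p)}"

text \<open>
  The infimum of \<^const>\<open>rep_lengths\<close> is a minimum (see \<open>Inf_rep_lengths_attained\<close> below);
  \<^const>\<open>Min\<close> is not applicable because the set is infinite.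
\<close>

definition diam_geom :: "nat \<Rightarrow> nat \<Rightarrow> (nat \<Rightarrow> int) \<Rightarrow> real" where
  "diam_geom p k a = Max ((\<lambda>x. Inf (rep_lengths p k a x)) ` carrier (Zmod p))"

lemma Inf_rep_lengths_attained:
  assumes p: "prime p" and j: "j < k" "\<not> int p dvd a j"
  shows "Inf (rep_lengths p k a x) \<in> rep_lengths p k a x"
proof -
  define N where
    "N = {nat (\<Sum>i<k. (n i)\<^sup>2) | n. [(\<Sum>i<k. n i * a i) = x] (mod int p)}"
  have len: "L2_set (\<lambda>i. real_of_int (n i)) {..<k} = sqrt (real (nat (\<Sum>i<k. (n i)\<^sup>2)))"
    for n :: "nat \<Rightarrow> int"
    by (simp add: L2_set_def sum_nonneg)
  have R: "rep_lengths p k a x = (\<lambda>m. sqrt (real m)) ` N"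
    unfolding rep_lengths_def N_def len by blast
  have "coprime (a j) (int p)"
    using p j(2) by (simp add: coprime_commute prime_imp_coprime)
  then obtain b where "[a j * b = 1] (mod int p)"
    using cong_solve_coprime_int by blast
  then have "[a j * b * x = 1 * x] (mod int p)"
    by (rule cong_scalar_right)
  moreover have "(\<Sum>i<k. (if i = j then b * x else 0) * a i) = a j * b * x"
  proof -
    have "(\<Sum>i<k. (if i = j then b * x else 0) * a i)
        = (\<Sum>i<k. if i = j then b * x * a i else 0)"
      by (intro sum.cong) auto
    then show ?thesis using j(1) by (simp add: mult_ac)
  qed
  ultimately have "[(\<Sum>i<k. (if i = j then b * x else 0) * a i) = x] (mod int p)"
    by simp
  then have "nat (\<Sum>i<k. (if i = j then b * x else 0)\<^sup>2) \<in> N"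
    unfolding N_def by (intro CollectI exI conjI) (rule refl)
  then obtain m where m: "m \<in> N" "\<And>m'. m' \<in> N \<Longrightarrow> m \<le> m'"
    using LeastI[of "\<lambda>m. m \<in> N"] Least_le[of "\<lambda>m. m \<in> N"] by blast
  have "Inf (rep_lengths p k a x) = sqrt (real m)"
    unfolding R using m by (intro cInf_eq_minimum) auto
  then show ?thesis
    using m(1) R by blast
qed

lemma representative_vector_exists:
  assumes p: "odd p" "p > 1" and A: "A \<in> sym_lazy_gen_sets p" and card: "card A = 2 * k + 1"
  shows "\<exists>a. representative_vector p A k a"
proof -
  interpret residues "int p" "Zmod p"
    using p by unfold_locales auto
  define R where "R = {x \<in> A. 0 < x \<and> 2 * x < int p}"
  have AC: "0 \<le> x \<and> x < int p" if "x \<in> A" for x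
  proof -
    from that have "x \<in> carrier (Zmod p)"
      using A unfolding sym_lazy_gen_sets_def by blast
    then show ?thesis by (simp add: res_carrier_eq)
  qed
  have neg: "\<ominus>\<^bsub>Zmod p\<^esub> x = int p - x" if "0 < x" "x < int p" for x
    using that by (simp add: res_neg_eq zmod_zminus1_eq_if)
  have symA: "int p - x \<in> A" if "x \<in> A" "x \<noteq> 0" for x
  proof -
    have "x \<in> carrier (Zmod p)"
      using AC[OF that(1)] by (simp add: res_carrier_eq)
    then have "\<ominus>\<^bsub>Zmod p\<^esub> x \<in> A"
      using A that(1) unfolding sym_lazy_gen_sets_def by blast
    then show ?thesis
      using neg[of x] AC[OF that(1)] that(2) by simp
  qed
  have zero: "0 \<in> A"
    using A unfolding sym_lazy_gen_sets_def res_zero_eq by blast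
  have finA: "finite A"
    using card by (intro card_ge_0_finite) simp
  have no_half: "2 * x \<noteq> int p" for x
    using p(1) by (metis even_of_nat dvd_triv_left)
  have split: "A - {0} = R \<union> (\<lambda>x. int p - x) ` R"
  proof (intro equalityI subsetI)
    fix x assume x: "x \<in> A - {0}"
    show "x \<in> R \<union> (\<lambda>x. int p - x) ` R"
    proof (cases "2 * x < int p")
      case True
      then show ?thesis using x AC[of x] by (auto simp: R_def)
    next
      case False
      then have "int p - x \<in> R"
        using x symA[of x] AC[of x] no_half[of x] by (auto simp: R_def)
      then show ?thesis by (intro UnI2 image_eqI[where x = "int p - x"]) auto
    qed
  next
    fix x assume "x \<in> R \<union> (\<lambda>x. int p - x) ` R"
    then show "x \<in> A - {0}"
      using symA AC by (fastforce simp: R_def)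
  qed
  have "card (A - {0}) = card R + card ((\<lambda>x. int p - x) ` R)"
    unfolding split using finA by (intro card_Un_disjoint) (auto simp: R_def)
  moreover have "card ((\<lambda>x. int p - x) ` R) = card R"
    by (intro card_image inj_onI) simp
  ultimately have "card R = k"
    using card zero finA by simp
  moreover have "finite R"
    using finA by (simp add: R_def)
  ultimately obtain a where a: "bij_betw a {..<k} R"
    using ex_bij_betw_nat_finite[of R] by (auto simp: atLeast0LessThan)
  have aR: "a i \<in> R" if "i < k" for i
    using a that by (auto simp: bij_betw_def)
  have uniq: "\<exists>!i. i < k \<and> a i = y" if "y \<in> R" for y
    using a that by (auto simp: bij_betw_def inj_on_def)
  have "\<exists>!i. i < k \<and> a i \<in> {x, \<ominus>\<^bsub>Zmod p\<^esub> x}" if x: "x \<in> A - {0}" for x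
  proof -
    have nx: "\<ominus>\<^bsub>Zmod p\<^esub> x = int p - x"
      using neg[of x] AC[of x] x by auto
    obtain y where y: "y \<in> R" "{x, int p - x} = {y, int p - y}"
      using x unfolding split by force
    have "a i \<in> {y, int p - y} \<longleftrightarrow> a i = y" if "i < k" for i
      using aR[OF that] y(1) by (auto simp: R_def)
    then show ?thesis
      using uniq[OF y(1)] unfolding nx y(2) by blast
  qed
  moreover have "a i \<in> A - {0}" if "i < k" for i
    using aR[OF that] by (simp add: R_def)
  ultimately have "representative_vector p A k a"
    unfolding representative_vector_def res_zero_eq by blast
  then show ?thesis by blast
qed

end

theory Submission
  imports Defs
begin

text \<open>
  Write \<open>d\<close> for the square of the geometric diameter. It is a positive integer, and every residue
  is \<open>v \<cdot> a\<close> for some \<open>v \<in> \<int>\<^sup>k\<close> with \<open>\<parallel>v\<parallel>\<^sup>2 \<le> d\<close>. The proof is spectral. With the eigenvalues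
  \<open>\<lambda>(\<xi>) = (1 + 2 \<Sum>\<^sub>i cos(2\<pi> \<xi> a\<^sub>i / p)) / (2k + 1)\<close> of the walk, Cauchy--Schwarz and Parseval bound the
  total variation distance at time \<open>n\<close> by the square root of \<open>(\<Sum>\<^sub>\<xi> \<lambda>(\<xi>)\<^bsup>2n\<^esup>) - 1\<close>
  (\<open>tv_dist_convolution_power_le\<close>).

  Put \<open>t = 2n / (2k + 1)\<close>. A nonnegative eigenvalue satisfies \<open>\<lambda>\<^bsup>2n\<^esup> \<le> exp(-2n(1 - \<lambda>))\<close>, which is the
  corresponding eigenvalue of the continuous-time walk. A negative one is at least
  \<open>-1 + 2/(2k + 1)\<close>, because \<open>0 \<in> A\<close>, and contributes at most \<open>exp(-2t)\<close>. So it suffices to bound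
  \<open>p exp(-2t)\<close> and the trace of the continuous-time walk (\<open>sum_eigenvalue_powers_le\<close>).

  The trace is \<open>p\<close> times the return probability of the continuous-time walk. That walk is the
  image of \<open>k\<close> independent walks on \<open>\<int>\<close>, whose transition probabilities are, up to a common factor,
  the modified Bessel functions \<open>b(m) = I\<^sub>m(2t)\<close>. For a Gaussian weight one would have
  \<open>b(m + v) b(m - v) = exp(-v\<^sup>2/t') b(m)\<^sup>2\<close>; the Bessel functions satisfy the corresponding lower bound
  with the factor \<open>(1 - 1/t)\<close> raised to the power \<open>v\<^sup>2\<close> (\<open>bessel_curvature\<close>,
  \<open>ratio_curvature_imp_log_curvature\<close>). By Cauchy--Schwarz this passes to sums over the cosets of
  the relation lattice (\<open>torus_kernel_log_curvature\<close>). Since the kernel is even, moving from \<open>0\<close> to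
  \<open>v \<cdot> a\<close> costs only a factor \<open>exp(-d/t)\<close>: the kernel is nearly constant when \<open>t\<close> is a large multiple
  of \<open>d\<close>, its total mass is known, and so its value at \<open>0\<close> is at most \<open>exp(d/t)\<close> times the average
  (\<open>torus_heat_trace_bound\<close>). This is the discrete form of the fact that the heat kernel of a flat
  torus is nearly uniform after the square of its diameter.

  Finally, counting the integer vectors in a box gives \<open>p \<le> (2\<surd>d + 1)\<^sup>k\<close>
  (\<open>card_le_of_covering\<close>). Together with \<open>k \<le> ln p / ln ln p\<close> this yields \<open>ln p \<le> 2\<surd>d + 1\<close>, so
  \<open>p exp(-2t)\<close> is negligible as well. Taking \<open>n = 24 k d\<close> makes \<open>t \<ge> 16 d\<close>, which is enough.
\<close>

section \<open>Modified Bessel functions of integer order\<close>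

definition exp_coeff :: "real \<Rightarrow> nat \<Rightarrow> real" where
  "exp_coeff t i = t ^ i / fact i"

text \<open>
  The modified Bessel function \<open>I\<^sub>m(2t)\<close>. Truncating \<open>m\<close> and \<open>-m\<close> to naturals covers both signs of the
  order at once: the two indices of the summand run through all pairs of naturals with difference \<open>m\<close>.
\<close>

definition bessel :: "real \<Rightarrow> int \<Rightarrow> real" where
  "bessel t m = (\<Sum>\<^sub>\<infinity>i. exp_coeff t (i + nat m) * exp_coeff t (i + nat (- m)))"

lemma exp_coeff_pos: "t > 0 \<Longrightarrow> exp_coeff t i > 0"
  by (simp add: exp_coeff_def)

lemma exp_coeff_Suc: "real (Suc i) * exp_coeff t (Suc i) = t * exp_coeff t i"
  by (simp add: exp_coeff_def divide_simps del: of_nat_Suc)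

lemma has_sum_exp_coeff_cis:
  assumes "t > 0"
  shows "((\<lambda>i. of_real (exp_coeff t i) * cis (real i * \<theta>)) has_sum exp (of_real t * cis \<theta>)) UNIV"
proof (rule norm_summable_imp_has_sum)
  have "summable (\<lambda>i. t ^ i /\<^sub>R fact i)"
    using summable_exp_generic[of t] .
  then show "summable (\<lambda>i. norm (complex_of_real (exp_coeff t i) * cis (real i * \<theta>)))"
    using assms by (simp add: norm_mult exp_coeff_def norm_divide norm_power norm_inverse divide_inverse mult.commute)
  have "(\<lambda>i. (of_real t * cis \<theta>) ^ i /\<^sub>R fact i) sums exp (of_real t * cis \<theta>)"
    by (rule exp_converges)
  moreover have "(of_real t * cis \<theta>) ^ i /\<^sub>R fact i = complex_of_real (exp_coeff t i) * cis (real i * \<theta>)" for i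
    by (simp add: exp_coeff_def power_mult_distrib Complex.DeMoivre scaleR_conv_of_real divide_inverse)
  ultimately show "(\<lambda>i. complex_of_real (exp_coeff t i) * cis (real i * \<theta>)) sums exp (of_real t * cis \<theta>)"
    by simp
qed

text \<open>
  A pair of naturals is determined by its difference and its minimum; this regroups the product of
  two exponential series by the order of the Bessel function.
\<close>

lemma bij_diff_min:
  "bij_betw (\<lambda>(m::int, i::nat). (i + nat m, i + nat (- m))) (UNIV \<times> UNIV) (UNIV \<times> UNIV)"
  by (rule bij_betwI[where g = "\<lambda>(x, y). (int x - int y, min x y)"]) auto

text \<open>
  The generating function of the Bessel functions before summation over the second index: multiply
  the series of \<open>exp(t e\<^bsup>i\<theta>\<^esup>)\<close> and \<open>exp(t e\<^bsup>-i\<theta>\<^esup>)\<close>, whose product is \<open>exp(2t cos \<theta>)\<close>.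
\<close>

lemma has_sum_exp_cis_double:
  assumes t: "t > 0"
  shows "((\<lambda>(m::int, i). of_real (exp_coeff t (i + nat m) * exp_coeff t (i + nat (- m))) * cis (real_of_int m * \<theta>))
           has_sum of_real (exp (2 * t * cos \<theta>))) (UNIV \<times> UNIV)"
proof -
  define e where "e \<theta> i = complex_of_real (exp_coeff t i) * cis (real i * \<theta>)" for \<theta> i
  have hs: "(e \<theta> has_sum exp (of_real t * cis \<theta>)) UNIV" for \<theta>
    unfolding e_def by (rule has_sum_exp_coeff_cis[OF t])
  have nsum: "(\<lambda>i. norm (e \<theta> i)) summable_on UNIV" for \<theta>
    using has_sum_imp_summable[OF hs] by (simp add: summable_on_iff_abs_summable_on_complex)
  have "(\<lambda>z. norm (case z of (x, y) \<Rightarrow> e \<theta> x * e (- \<theta>) y)) summable_on UNIV \<times> UNIV"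
  proof (subst Infinite_Sum.abs_summable_on_Sigma_iff, intro conjI ballI)
    fix x
    show "(\<lambda>y. norm (case (x, y) of (x, y) \<Rightarrow> e \<theta> x * e (- \<theta>) y)) summable_on UNIV"
      using summable_on_cmult_right[OF nsum] by (simp add: norm_mult)
  next
    define S where "S = (\<Sum>\<^sub>\<infinity>y. norm (e (- \<theta>) y))"
    have "S \<ge> 0" unfolding S_def by (rule infsum_nonneg) simp
    moreover have "(\<lambda>x. norm (e \<theta> x) * S) summable_on UNIV"
      by (rule summable_on_cmult_left[OF nsum])
    ultimately show "(\<lambda>x. norm (\<Sum>\<^sub>\<infinity>y. norm (case (x, y) of (x, y) \<Rightarrow> e \<theta> x * e (- \<theta>) y))) summable_on UNIV"
      by (simp add: norm_mult infsum_cmult_right' abs_mult S_def[symmetric])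
  qed
  then have "(\<lambda>(x, y). e \<theta> x * e (- \<theta>) y) summable_on UNIV \<times> UNIV"
    by (rule abs_summable_summable)
  then have "((\<lambda>(x, y). e \<theta> x * e (- \<theta>) y) has_sum exp (of_real t * cis \<theta>) * exp (of_real t * cis (- \<theta>)))
      (UNIV \<times> UNIV)"
    by (intro has_sum_SigmaI[where g = "\<lambda>x. e \<theta> x * exp (of_real t * cis (- \<theta>))"])
       (auto intro!: has_sum_cmult_right has_sum_cmult_left hs)
  also have "exp (of_real t * cis \<theta>) * exp (of_real t * cis (- \<theta>)) = complex_of_real (exp (2 * t * cos \<theta>))"
  proof -
    have "of_real t * cis \<theta> + of_real t * cis (- \<theta>) = complex_of_real (2 * t * cos \<theta>)"
      by (simp add: complex_eq_iff)
    then show ?thesis by (metis exp_add exp_of_real)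
  qed
  finally have "((\<lambda>(x, y). e \<theta> x * e (- \<theta>) y) has_sum of_real (exp (2 * t * cos \<theta>))) (UNIV \<times> UNIV)" .
  then have "((\<lambda>z. case (case z of (m::int, i) \<Rightarrow> (i + nat m, i + nat (- m))) of (x, y) \<Rightarrow> e \<theta> x * e (- \<theta>) y)
      has_sum of_real (exp (2 * t * cos \<theta>))) (UNIV \<times> UNIV)"
    by (subst has_sum_reindex_bij_betw[OF bij_diff_min])
  moreover have "e \<theta> (i + nat m) * e (- \<theta>) (i + nat (- m))
      = of_real (exp_coeff t (i + nat m) * exp_coeff t (i + nat (- m))) * cis (real_of_int m * \<theta>)" for m i
  proof -
    have "real (i + nat m) * \<theta> + real (i + nat (- m)) * (- \<theta>) = real_of_int m * \<theta>"
      by (cases "m \<ge> 0") (auto simp: algebra_simps)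
    then show ?thesis
      by (simp add: e_def mult_ac cis_mult[symmetric] del: cis_mult) (simp add: cis_mult algebra_simps)
  qed
  ultimately show ?thesis by (simp add: case_prod_unfold)
qed

lemma bessel_summable:
  assumes t: "t > 0"
  shows "(\<lambda>i. exp_coeff t (i + nat m) * exp_coeff t (i + nat (- m))) summable_on UNIV"
proof -
  have "(\<lambda>(m::int, i). complex_of_real (exp_coeff t (i + nat m) * exp_coeff t (i + nat (- m)))) summable_on (UNIV \<times> UNIV)"
    using has_sum_imp_summable[OF has_sum_exp_cis_double[OF t, of 0]] by simp
  then have "(\<lambda>i. complex_of_real (exp_coeff t (i + nat m) * exp_coeff t (i + nat (- m)))) summable_on UNIV"
    by (rule summable_on_SigmaD1) simp
  then have "(\<lambda>i. Re (complex_of_real (exp_coeff t (i + nat m) * exp_coeff t (i + nat (- m))))) summable_on UNIV"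
    by (rule summable_on_Re)
  then show ?thesis by simp
qed

lemma bessel_has_sum:
  assumes t: "t > 0"
  shows "((\<lambda>i. exp_coeff t (i + nat m) * exp_coeff t (i + nat (- m))) has_sum bessel t m) UNIV"
  unfolding bessel_def by (rule has_sum_infsum[OF bessel_summable[OF t]])

text \<open>
  The phase \<open>\<alpha>\<close> is what turns multiplication by \<open>exp(2t cos \<theta>)\<close> into a convolution in the
  variable dual to \<open>\<theta>\<close>.
\<close>

lemma bessel_fourier:
  assumes t: "t > 0"
  shows "((\<lambda>m. bessel t m * cos (\<alpha> - real_of_int m * \<theta>)) has_sum exp (2 * t * cos \<theta>) * cos \<alpha>) UNIV"
proof -
  have "((\<lambda>m. complex_of_real (bessel t m) * cis (real_of_int m * (- \<theta>))) has_sum of_real (exp (2 * t * cos (- \<theta>)))) UNIV"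
    by (rule has_sum_SigmaD[OF has_sum_exp_cis_double[OF t]])
       (auto simp: case_prod_unfold simp del: of_real_mult
          intro!: has_sum_cmult_left has_sum_of_real bessel_has_sum[OF t])
  then have "((\<lambda>m. Re (cis \<alpha> * (complex_of_real (bessel t m) * cis (real_of_int m * (- \<theta>)))))
      has_sum Re (cis \<alpha> * of_real (exp (2 * t * cos (- \<theta>))))) UNIV"
    by (intro has_sum_Re has_sum_cmult_right)
  moreover have "Re (cis \<alpha> * (complex_of_real (bessel t m) * cis (real_of_int m * (- \<theta>))))
      = bessel t m * cos (\<alpha> - real_of_int m * \<theta>)" for m
    by (simp add: cos_diff algebra_simps)
  ultimately show ?thesis by (simp add: mult.commute)
qed

lemma bessel_minus: "bessel t (- m) = bessel t m"
  by (simp add: bessel_def mult.commute)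

lemma bessel_pos:
  assumes t: "t > 0" shows "bessel t m > 0"
proof -
  let ?f = "\<lambda>i. exp_coeff t (i + nat m) * exp_coeff t (i + nat (- m))"
  have "sum ?f {0} \<le> bessel t m"
    by (rule finite_sum_le_has_sum[OF bessel_has_sum[OF t]])
       (simp_all add: exp_coeff_pos[OF t] less_imp_le)
  moreover have "sum ?f {0} > 0"
    using exp_coeff_pos[OF t] by simp
  ultimately show ?thesis by linarith
qed

lemma bessel_tendsto_0:
  assumes t: "t > 0" shows "(\<lambda>w. bessel t (int w)) \<longlonglongrightarrow> 0"
proof -
  have "bessel t summable_on UNIV"
    using has_sum_imp_summable[OF bessel_fourier[OF t, of 0 0]] by simp
  then have "bessel t summable_on range int"
    by (rule summable_on_subset) simp
  then have "(\<lambda>w. bessel t (int w)) summable_on UNIV"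
    by (subst (asm) summable_on_reindex) (auto simp: o_def)
  then show ?thesis
    by (intro summable_LIMSEQ_zero summable_on_imp_summable)
qed

text \<open>
  Termwise this is \<open>(i + 1) c(i + 1) = t c(i)\<close> for the exponential coefficients, applied to either factor
  of the series.
\<close>

lemma bessel_recurrence:
  assumes t: "t > 0"
  shows "t * (bessel t (int w) - bessel t (int w + 2)) = real (Suc w) * bessel t (int w + 1)"
proof -
  define c where "c = exp_coeff t"
  have sums: "(\<lambda>i. c (i + n) * c i) sums bessel t (int n)" for n
    using has_sum_imp_sums[OF bessel_has_sum[OF t, of "int n"]] by (simp add: c_def)
  have c: "t * c i = real (Suc i) * c (Suc i)" for i
    by (simp only: c_def exp_coeff_Suc)
  have "(\<lambda>i. real i * (c (i + Suc w) * c i)) sums (t * bessel t (int w + 2))"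
  proof -
    have "(\<lambda>i. t * (c (i + Suc (Suc w)) * c i)) sums (t * bessel t (int (Suc (Suc w))))"
      by (intro sums_mult sums)
    moreover have "(\<lambda>i. t * (c (i + Suc (Suc w)) * c i)) = (\<lambda>i. real (Suc i) * (c (Suc i + Suc w) * c (Suc i)))"
    proof
      fix i
      have "t * (c (i + Suc (Suc w)) * c i) = c (i + Suc (Suc w)) * (t * c i)"
        by (simp only: mult_ac)
      also have "\<dots> = real (Suc i) * (c (Suc i + Suc w) * c (Suc i))"
        unfolding c by simp
      finally show "t * (c (i + Suc (Suc w)) * c i) = real (Suc i) * (c (Suc i + Suc w) * c (Suc i))" .
    qed
    ultimately have "(\<lambda>i. real (Suc i) * (c (Suc i + Suc w) * c (Suc i))) sums (t * bessel t (int w + 2))"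
      by (simp only: of_nat_Suc) (simp add: add.commute)
    then show ?thesis
      using sums_Suc_iff[of "\<lambda>i. real i * (c (i + Suc w) * c i)"] by simp
  qed
  moreover have "(\<lambda>i. real (Suc (i + w)) * (c (i + Suc w) * c i)) sums (t * bessel t (int w))"
  proof -
    have "(\<lambda>i. t * (c (i + w) * c i)) sums (t * bessel t (int w))"
      by (intro sums_mult sums)
    moreover have "t * (c (i + w) * c i) = real (Suc (i + w)) * (c (i + Suc w) * c i)" for i
      using arg_cong[OF c[of "i + w"], of "\<lambda>x. x * c i"] by (simp add: mult_ac)
    ultimately show ?thesis by simp
  qed
  ultimately have "(\<lambda>i. real (Suc (i + w)) * (c (i + Suc w) * c i) - real i * (c (i + Suc w) * c i))
      sums (t * bessel t (int w) - t * bessel t (int w + 2))"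
    by (intro sums_diff)
  moreover have "real (Suc (i + w)) * (c (i + Suc w) * c i) - real i * (c (i + Suc w) * c i)
      = real (Suc w) * (c (i + Suc w) * c i)" for i
    by (simp add: algebra_simps)
  moreover have "(\<lambda>i. real (Suc w) * (c (i + Suc w) * c i)) sums (real (Suc w) * bessel t (int (Suc w)))"
    by (intro sums_mult sums)
  ultimately show ?thesis
    by (simp add: sums_iff algebra_simps)
qed

lemma bessel_two_step_mono:
  assumes t: "t > 0" shows "bessel t (int w + 2) \<le> bessel t (int w)"
proof -
  have "t * (bessel t (int w) - bessel t (int w + 2)) \<ge> 0"
    unfolding bessel_recurrence[OF t] using bessel_pos[OF t, of "int w + 1"] by simp
  then show ?thesis using t by (simp add: zero_le_mult_iff)
qed

definition turan_determinant :: "real \<Rightarrow> nat \<Rightarrow> real" where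
  "turan_determinant t w = (bessel t (int w))\<^sup>2 - bessel t (int w - 1) * bessel t (int w + 1)"

text \<open>
  Substituting the recurrence for the outer orders cancels the squares. Consecutive Turan
  determinants therefore add up to a quantity that decreases in the order.
\<close>

lemma turan_add:
  assumes t: "t > 0"
  shows "turan_determinant t w + turan_determinant t (Suc w) = bessel t (int w) * bessel t (int w + 1) / t"
proof -
  define x where "x = bessel t (int w)"
  define y where "y = bessel t (int w + 1)"
  define z where "z = bessel t (int w + 2)"
  define u where "u = bessel t (int w - 1)"
  have z: "t * z = t * x - real (Suc w) * y"
    using bessel_recurrence[OF t, of w] by (simp add: x_def y_def z_def algebra_simps)
  have u: "t * u = t * y + real w * x"
  proof (cases w)
    case 0
    then show ?thesis using bessel_minus[of t 1] by (simp add: u_def y_def x_def)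
  next
    case (Suc v)
    then show ?thesis
      using bessel_recurrence[OF t, of v] by (simp add: x_def y_def u_def algebra_simps)
  qed
  have "t * (x\<^sup>2 - u * y + (y\<^sup>2 - x * z)) = t * x\<^sup>2 - (t * u) * y + t * y\<^sup>2 - x * (t * z)"
    by (simp add: algebra_simps)
  also have "\<dots> = x * y"
    unfolding z u by (simp add: algebra_simps power2_eq_square)
  finally have "x\<^sup>2 - u * y + (y\<^sup>2 - x * z) = x * y / t"
    using t by (simp add: field_simps)
  then show ?thesis
    by (simp add: turan_determinant_def x_def y_def z_def u_def add.commute)
qed

text \<open>
  The right-hand side of \<open>turan_add\<close> decreases in the order, by two-step monotonicity alone. So the
  determinant decreases in steps of two, and it tends to \<open>0\<close>.
\<close>

lemma turan_nonneg:
  assumes t: "t > 0" shows "turan_determinant t w \<ge> 0"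
proof -
  have step: "turan_determinant t (w + 2) \<le> turan_determinant t w" for w
  proof -
    have "bessel t (int w + 1) * bessel t (int w + 2) \<le> bessel t (int w) * bessel t (int w + 1)"
      using bessel_two_step_mono[OF t, of w] bessel_pos[OF t, of "int w + 1"] by (simp add: mult.commute)
    then have "bessel t (int w + 1) * bessel t (int w + 2) / t \<le> bessel t (int w) * bessel t (int w + 1) / t"
      using t by (intro divide_right_mono) auto
    then show ?thesis
      using turan_add[OF t, of w] turan_add[OF t, of "Suc w"] by (simp add: add.commute)
  qed
  have "turan_determinant t (w + 2 * n) \<le> turan_determinant t w" for n
    by (induction n) (use step order_trans in fastforce)+
  moreover have "(\<lambda>n. turan_determinant t (w + 2 * n)) \<longlonglongrightarrow> 0"
  proof -
    have lim: "(\<lambda>n. bessel t (int (f n))) \<longlonglongrightarrow> 0" if "strict_mono f" for f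
      using LIMSEQ_subseq_LIMSEQ[OF bessel_tendsto_0[OF t] that] by (simp add: o_def)
    have "(\<lambda>n. (bessel t (int (w + 2 * Suc n)))\<^sup>2
        - bessel t (int (w + 2 * n + 1)) * bessel t (int (w + 2 * Suc n + 1))) \<longlonglongrightarrow> 0\<^sup>2 - 0 * 0"
      by (intro tendsto_intros lim) (auto simp: strict_mono_def)
    then have "(\<lambda>n. turan_determinant t (w + 2 * Suc n)) \<longlonglongrightarrow> 0"
      by (simp add: turan_determinant_def algebra_simps)
    then show ?thesis by (rule LIMSEQ_imp_Suc)
  qed
  ultimately show ?thesis
    by (intro LIMSEQ_le_const2) auto
qed

text \<open>
  A reverse log-concavity. By \<open>turan_add\<close> and \<open>turan_nonneg\<close> the defect of log-concavity is at most
  \<open>b(w) b(w + 1) / t\<close>. This is what is needed if \<open>b(w + 1) \<le> b(w)\<close>; otherwise both neighbours of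
  \<open>b(w)\<close> exceed it and there is nothing to lose.
\<close>

lemma bessel_curvature:
  assumes t: "t > 0"
  shows "bessel t (m + 1) * bessel t (m - 1) \<ge> (1 - 1 / t) * (bessel t m)\<^sup>2"
proof -
  have *: "bessel t (int w + 1) * bessel t (int w - 1) \<ge> (1 - 1 / t) * (bessel t (int w))\<^sup>2" for w
  proof (cases "bessel t (int w + 1) \<le> bessel t (int w)")
    case True
    have "turan_determinant t w \<le> bessel t (int w) * bessel t (int w + 1) / t"
      using turan_add[OF t, of w] turan_nonneg[OF t, of "Suc w"] by linarith
    also have "\<dots> \<le> bessel t (int w) * bessel t (int w) / t"
      using True bessel_pos[OF t, of "int w"] t by (intro divide_right_mono mult_left_mono) auto
    finally show ?thesis
      by (simp add: turan_determinant_def algebra_simps power2_eq_square)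
  next
    case False
    have "bessel t (int w + 1) \<le> bessel t (int w - 1)"
    proof (cases w)
      case 0
      then show ?thesis using bessel_minus[of t 1] by simp
    next
      case (Suc v)
      then show ?thesis using bessel_two_step_mono[OF t, of v] by (simp add: add.commute)
    qed
    then have "bessel t (int w) * bessel t (int w) \<le> bessel t (int w + 1) * bessel t (int w - 1)"
      using False bessel_pos[OF t, of "int w"] by (intro mult_mono) auto
    moreover have "(1 - 1 / t) * (bessel t (int w))\<^sup>2 \<le> 1 * (bessel t (int w))\<^sup>2"
      using t by (intro mult_right_mono) auto
    ultimately show ?thesis by (simp add: power2_eq_square)
  qed
  show ?thesis
  proof (cases "m \<ge> 0")
    case True
    then show ?thesis using *[of "nat m"] by simp
  next
    case False
    then show ?thesis
      using *[of "nat (- m)"] bessel_minus[of t m] bessel_minus[of t "m + 1"] bessel_minus[of t "m - 1"]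
      by (simp add: algebra_simps minus_diff_commute)
  qed
qed

text \<open>
  The ratio of consecutive values drops by at most a factor \<open>\<kappa>\<close> per step. Each of the \<open>\<bar>v\<bar>\<close> ratios
  between \<open>m\<close> and \<open>m + \<bar>v\<bar>\<close> is compared with the one \<open>\<bar>v\<bar>\<close> steps before it, which gives the exponent
  \<open>v\<^sup>2\<close> of a Gaussian.
\<close>

lemma ratio_curvature_imp_log_curvature:
  fixes b :: "int \<Rightarrow> real"
  assumes pos: "\<And>m. b m > 0" and \<kappa>: "\<kappa> > 0"
    and curv: "\<And>m. b (m + 1) * b (m - 1) \<ge> \<kappa> * (b m)\<^sup>2"
  shows "b (m + v) * b (m - v) \<ge> \<kappa> ^ nat (v\<^sup>2) * (b m)\<^sup>2"
proof -
  define q where "q m = b (m + 1) / b m" for m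
  have qpos: "q m > 0" for m using pos by (simp add: q_def)
  have q1: "q m \<ge> \<kappa> * q (m - 1)" for m
    using curv[of m] pos[of m] pos[of "m - 1"] by (simp add: q_def field_simps power2_eq_square)
  have qd: "q m \<ge> \<kappa> ^ d * q (m - int d)" for m d
  proof (induction d)
    case (Suc d)
    have "\<kappa> ^ Suc d * q (m - int (Suc d)) = \<kappa> ^ d * (\<kappa> * q (m - int d - 1))"
      by (simp add: algebra_simps)
    also have "\<dots> \<le> \<kappa> ^ d * q (m - int d)"
      using q1[of "m - int d"] \<kappa> by (intro mult_left_mono) auto
    finally show ?case using Suc.IH by linarith
  qed simp
  have up: "b (m + int n) = b m * (\<Prod>j<n. q (m + int j))" for m n
    by (induction n) (use pos in \<open>auto simp: q_def field_simps less_imp_neq[symmetric]\<close>)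
  have main: "b (m + int n) * b (m - int n) \<ge> \<kappa> ^ (n\<^sup>2) * (b m)\<^sup>2" for n
  proof -
    have "(\<Prod>j<n. \<kappa> ^ n * q (m - int n + int j)) \<le> (\<Prod>j<n. q (m + int j))"
    proof (intro prod_mono conjI)
      fix j
      show "0 \<le> \<kappa> ^ n * q (m - int n + int j)"
        using \<kappa> qpos[of "m - int n + int j"] by simp
      show "\<kappa> ^ n * q (m - int n + int j) \<le> q (m + int j)"
        using qd[of n "m + int j"] by (simp add: algebra_simps)
    qed
    then have "\<kappa> ^ (n\<^sup>2) * (\<Prod>j<n. q (m - int n + int j)) \<le> (\<Prod>j<n. q (m + int j))"
      by (simp add: prod.distrib power_mult[symmetric] power2_eq_square)
    then have "b (m - int n) * b m * (\<kappa> ^ (n\<^sup>2) * (\<Prod>j<n. q (m - int n + int j)))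
        \<le> b (m - int n) * b m * (\<Prod>j<n. q (m + int j))"
      using pos[of m] pos[of "m - int n"] by (intro mult_left_mono) auto
    moreover have "b m = b (m - int n) * (\<Prod>j<n. q (m - int n + int j))"
      using up[of "m - int n" n] by simp
    moreover have "b (m + int n) = b m * (\<Prod>j<n. q (m + int j))"
      by (rule up)
    ultimately show ?thesis
      by (simp add: power2_eq_square mult_ac)
  qed
  have v2: "nat (v\<^sup>2) = (nat \<bar>v\<bar>)\<^sup>2"
    by (metis nat_abs_mult_distrib abs_power2 power2_eq_square)
  show ?thesis
  proof (cases "v \<ge> 0")
    case True
    then show ?thesis using main[of "nat v"] v2 by simp
  next
    case False
    then show ?thesis using main[of "nat (- v)"] v2 by (simp add: mult.commute)
  qed
qed

section \<open>Cosine sums over the residues modulo p\<close>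

definition cos_mod :: "nat \<Rightarrow> int \<Rightarrow> real" where
  "cos_mod p x = cos (2 * pi * real_of_int x / real p)"

lemma cos_mod_0 [simp]: "cos_mod p 0 = 1"
  by (simp add: cos_mod_def)

lemma cos_mod_minus [simp]: "cos_mod p (- x) = cos_mod p x"
  by (simp add: cos_mod_def)

lemma cos_mod_mult:
  "cos_mod p x * cos_mod p y = (cos_mod p (x - y) + cos_mod p (x + y)) / 2"
  by (simp add: cos_mod_def cos_times_cos ring_distribs add_divide_distrib diff_divide_distrib)

lemma cos_mod_cong:
  assumes "p > 0" "[x = y] (mod int p)"
  shows "cos_mod p x = cos_mod p y"
proof -
  obtain j where j: "y = x + int p * j"
    using assms(2) by (auto simp: cong_iff_lin)
  have "2 * pi * real_of_int y / real p = 2 * pi * real_of_int x / real p + 2 * pi * real_of_int j"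
    using assms(1) by (simp add: j distrib_left add_divide_distrib)
  then show ?thesis
    by (simp add: cos_mod_def cos_add)
qed

lemma cos_mod_orthogonality:
  assumes p: "p > 0"
  shows "(\<Sum>\<xi>\<in>{0..<int p}. cos_mod p (\<xi> * x)) = (if int p dvd x then real p else 0)"
proof (cases "int p dvd x")
  case True
  have "cos_mod p (\<xi> * x) = 1" for \<xi>
    using cos_mod_cong[OF p, of "\<xi> * x" 0] True by (simp add: cong_0_iff)
  then show ?thesis using True by simp
next
  case False
  define z where "z = cis (2 * pi * real_of_int x / real p)"
  have "z \<noteq> 1"
  proof
    assume "z = 1"
    then have "cos (2 * pi * real_of_int x / real p) = 1"
      by (simp add: z_def complex_eq_iff)
    then obtain n :: int where "2 * pi * real_of_int x / real p = real_of_int n * 2 * pi"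
      by (subst (asm) cos_one_2pi_int) blast
    then have "2 * pi * real_of_int x = 2 * pi * real_of_int (n * int p)"
      using p by (simp add: divide_eq_eq)
    then have "real_of_int x = real_of_int (n * int p)"
      by simp
    then have "x = n * int p"
      by (simp only: of_int_eq_iff)
    then show False using False by simp
  qed
  moreover have "z ^ p = 1"
  proof -
    have "z ^ p = cis (2 * pi * real_of_int x)"
      using p unfolding z_def Complex.DeMoivre by simp
    also have "\<dots> = 1"
      by (rule cis_multiple_2pi) simp
    finally show ?thesis .
  qed
  ultimately have "(\<Sum>j<p. z ^ j) = 0"
    by (simp add: geometric_sum)
  then have "(\<Sum>j<p. Re (z ^ j)) = 0"
    by (simp only: Re_sum[symmetric] zero_complex.sel)
  moreover have "Re (z ^ j) = cos_mod p (int j * x)" for j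
    unfolding z_def Complex.DeMoivre cos_mod_def by (simp add: mult_ac)
  moreover have "(\<Sum>\<xi>\<in>{0..<int p}. cos_mod p (\<xi> * x)) = (\<Sum>j<p. cos_mod p (int j * x))"
    by (rule sum.reindex_bij_witness[of _ int nat]) auto
  ultimately show ?thesis using False by simp
qed

lemma sum_residues_delta:
  assumes p: "p > 0" and L: "\<And>x y. [x = y] (mod int p) \<Longrightarrow> L x = (L y :: real)"
  shows "(\<Sum>\<eta>\<in>{0..<int p}. L \<eta> * (if int p dvd (y - \<eta>) then c else 0)) = L y * c"
proof -
  have "(int p dvd (y - \<eta>)) = (\<eta> = y mod int p)" if "\<eta> \<in> {0..<int p}" for \<eta>
    using that by (auto simp: mod_eq_dvd_iff[symmetric])
  then have "(\<Sum>\<eta>\<in>{0..<int p}. L \<eta> * (if int p dvd (y - \<eta>) then c else 0))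
      = (\<Sum>\<eta>\<in>{0..<int p}. if \<eta> = y mod int p then L \<eta> * c else 0)"
    by (intro sum.cong) auto
  also have "\<dots> = L (y mod int p) * c"
    using p by simp
  also have "L (y mod int p) = L y"
    by (rule L) (simp add: cong_def)
  finally show ?thesis .
qed

text \<open>
  For even coefficients the cosine transform suffices: each product of two cosines splits into
  frequencies \<open>\<xi> - \<eta>\<close> and \<open>\<xi> + \<eta>\<close>, which contribute half of the coefficient at \<open>\<xi>\<close> and half of that
  at \<open>-\<xi>\<close>.
\<close>

lemma even_parseval:
  assumes p: "p > 0" and L: "\<And>x y. [x = y] (mod int p) \<Longrightarrow> L x = (L y :: real)"
    and even: "\<And>x. L (- x) = L x"
    and f: "\<And>x. x \<in> {0..<int p} \<Longrightarrow> f x = (\<Sum>\<xi>\<in>{0..<int p}. L \<xi> * cos_mod p (\<xi> * x)) / real p"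
  shows "(\<Sum>x\<in>{0..<int p}. (f x)\<^sup>2) = (\<Sum>\<xi>\<in>{0..<int p}. (L \<xi>)\<^sup>2) / real p"
proof -
  let ?I = "{0..<int p}"
  have "(\<Sum>x\<in>?I. (f x)\<^sup>2) = (\<Sum>x\<in>?I. f x * ((\<Sum>\<xi>\<in>?I. L \<xi> * cos_mod p (\<xi> * x)) / real p))"
    by (intro sum.cong refl) (simp only: f[symmetric] power2_eq_square)
  also have "\<dots> = (\<Sum>x\<in>?I. \<Sum>\<xi>\<in>?I. L \<xi> * (f x * cos_mod p (\<xi> * x))) / real p"
    by (simp add: sum_distrib_left sum_divide_distrib mult_ac)
  also have "\<dots> = (\<Sum>\<xi>\<in>?I. L \<xi> * (\<Sum>x\<in>?I. f x * cos_mod p (\<xi> * x))) / real p"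
    by (subst sum.swap) (simp add: sum_distrib_left)
  also have "(\<Sum>\<xi>\<in>?I. L \<xi> * (\<Sum>x\<in>?I. f x * cos_mod p (\<xi> * x))) = (\<Sum>\<xi>\<in>?I. (L \<xi>)\<^sup>2)"
  proof (rule sum.cong[OF refl])
    fix \<xi>
    have "(\<Sum>x\<in>?I. f x * cos_mod p (\<xi> * x))
        = (\<Sum>x\<in>?I. \<Sum>\<eta>\<in>?I. L \<eta> * (cos_mod p (\<xi> * x) * cos_mod p (\<eta> * x)) / real p)"
      by (intro sum.cong refl, subst f) (simp_all add: sum_divide_distrib sum_distrib_right sum_distrib_left mult_ac)
    also have "\<dots> = (\<Sum>\<eta>\<in>?I. \<Sum>x\<in>?I. L \<eta> * (cos_mod p (\<xi> * x) * cos_mod p (\<eta> * x)) / real p)"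
      by (rule sum.swap)
    also have "\<dots> = (\<Sum>\<eta>\<in>?I. L \<eta> / (2 * real p) *
        ((\<Sum>x\<in>?I. cos_mod p (x * (\<xi> - \<eta>))) + (\<Sum>x\<in>?I. cos_mod p (x * (\<xi> + \<eta>)))))"
    proof (rule sum.cong[OF refl])
      fix \<eta>
      have "L \<eta> * (cos_mod p (\<xi> * x) * cos_mod p (\<eta> * x)) / real p
          = L \<eta> / (2 * real p) * (cos_mod p (x * (\<xi> - \<eta>)) + cos_mod p (x * (\<xi> + \<eta>)))" for x
        unfolding cos_mod_mult by (simp add: right_diff_distrib distrib_left mult.commute add_divide_distrib)
      then show "(\<Sum>x\<in>?I. L \<eta> * (cos_mod p (\<xi> * x) * cos_mod p (\<eta> * x)) / real p) = L \<eta> / (2 * real p) *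
          ((\<Sum>x\<in>?I. cos_mod p (x * (\<xi> - \<eta>))) + (\<Sum>x\<in>?I. cos_mod p (x * (\<xi> + \<eta>))))"
        by (simp only: sum_distrib_left[symmetric] sum.distrib)
    qed
    also have "\<dots> = (\<Sum>\<eta>\<in>?I. L \<eta> * (if int p dvd (\<xi> - \<eta>) then 1 / 2 else 0))
        + (\<Sum>\<eta>\<in>?I. L \<eta> * (if int p dvd (- \<xi> - \<eta>) then 1 / 2 else 0))"
    proof -
      have "- \<xi> - \<eta> = - (\<xi> + \<eta>)" for \<eta> by simp
      then have "int p dvd (- \<xi> - \<eta>) \<longleftrightarrow> int p dvd (\<xi> + \<eta>)" for \<eta>
        by (simp only: dvd_minus_iff)
      then show ?thesis
        unfolding cos_mod_orthogonality[OF p] sum.distrib[symmetric]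
        using p by (intro sum.cong) (auto simp: field_simps)
    qed
    also have "\<dots> = L \<xi>"
    proof -
      have "(\<Sum>\<eta>\<in>?I. L \<eta> * (if int p dvd (y - \<eta>) then 1 / 2 else 0)) = L y * (1 / 2)" for y
        by (rule sum_residues_delta[OF p]) (rule L)
      then show ?thesis by (simp only: even)
    qed
    finally show "L \<xi> * (\<Sum>x\<in>?I. f x * cos_mod p (\<xi> * x)) = (L \<xi>)\<^sup>2"
      by (simp add: power2_eq_square)
  qed
  finally show ?thesis .
qed

section \<open>The heat kernel on the cyclic group\<close>

lemma has_sum_sum_finite:
  fixes f :: "'a \<Rightarrow> 'b \<Rightarrow> real"
  assumes "finite F" "\<And>\<xi>. \<xi> \<in> F \<Longrightarrow> (f \<xi> has_sum g \<xi>) A"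
  shows "((\<lambda>m. \<Sum>\<xi>\<in>F. f \<xi> m) has_sum (\<Sum>\<xi>\<in>F. g \<xi>)) A"
  using assms by (induction F rule: finite_induct) (auto intro!: has_sum_add)

text \<open>
  Summing the inequality \<open>2z \<le> l u + w/l\<close> of the arithmetic and geometric means and then choosing
  \<open>l\<close> avoids any question of square summability.
\<close>

lemma Cauchy_Schwarz_has_sum:
  fixes u w z :: "'a \<Rightarrow> real"
  assumes U: "(u has_sum U) A" and W: "(w has_sum W) A" and Z: "(z has_sum Z) A"
    and nonneg: "\<And>m. m \<in> A \<Longrightarrow> u m \<ge> 0" "\<And>m. m \<in> A \<Longrightarrow> w m \<ge> 0" "\<And>m. m \<in> A \<Longrightarrow> z m \<ge> 0"
    and le: "\<And>m. m \<in> A \<Longrightarrow> (z m)\<^sup>2 \<le> u m * w m"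
  shows "Z\<^sup>2 \<le> U * W"
proof -
  have Z0: "Z \<ge> 0" and U0: "U \<ge> 0" and W0: "W \<ge> 0"
    using has_sum_nonneg[OF Z] has_sum_nonneg[OF U] has_sum_nonneg[OF W] nonneg by auto
  have amgm: "2 * Z \<le> l * U + W / l" if l: "l > 0" for l
  proof (rule has_sum_mono)
    show "((\<lambda>m. 2 * z m) has_sum 2 * Z) A"
      by (intro has_sum_cmult_right Z)
    show "((\<lambda>m. l * u m + w m / l) has_sum l * U + W / l) A"
      by (intro has_sum_add has_sum_cmult_right has_sum_divide_const U W)
    fix m assume m: "m \<in> A"
    have "(2 * z m)\<^sup>2 \<le> 4 * ((l * u m) * (w m / l))"
      using le[OF m] l by (simp add: power_mult_distrib)
    also have "\<dots> \<le> (l * u m + w m / l)\<^sup>2"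
    proof -
      have "4 * (x * y) \<le> (x + y)\<^sup>2" for x y :: real
        using sum_squares_bound[of x y] by (simp add: power2_sum)
      then show ?thesis .
    qed
    finally show "2 * z m \<le> l * u m + w m / l"
      using nonneg m l by (intro power2_le_imp_le[of "2 * z m"]) auto
  qed
  show ?thesis
  proof (cases "Z = 0")
    case True
    then show ?thesis using U0 W0 by simp
  next
    case False
    then have Zpos: "Z > 0" using Z0 by simp
    show ?thesis
    proof (cases "U = 0")
      case True
      \<comment> \<open>Without the term in \<open>U\<close>, any \<open>l > W / (2 * Z)\<close> gives a contradiction.\<close>
      have "2 * Z \<le> W / (W / Z + 1)"
        using amgm[of "W / Z + 1"] W0 Zpos True by (simp add: add_nonneg_pos)
      then have "2 * Z * (W / Z + 1) \<le> W"
        using W0 Zpos by (simp add: pos_le_divide_eq add_nonneg_pos)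
      moreover have "2 * Z * (W / Z + 1) = 2 * W + 2 * Z"
        using Zpos by (simp add: distrib_left)
      ultimately have "2 * W + 2 * Z \<le> W" by simp
      then show ?thesis using W0 Zpos by simp
    next
      case False
      then have Upos: "U > 0" using U0 by simp
      have "2 * Z \<le> Z + W * U / Z"
        using amgm[of "Z / U"] Zpos Upos by simp
      then have "Z * Z \<le> W * U"
        using Zpos by (simp add: field_simps)
      then show ?thesis by (simp add: power2_eq_square mult.commute)
    qed
  qed
qed

text \<open>
  Up to the factor \<open>exp(2tk)\<close> this is the law, at a time proportional to \<open>t\<close>, of the continuous-time
  walk with steps \<open>\<plusminus>a\<^sub>i\<close>, written as a Fourier inversion. Without the factor,
  each generator contributes exactly the generating function of the Bessel functions.
\<close>

definition torus_kernel :: "nat \<Rightarrow> real \<Rightarrow> (nat \<Rightarrow> int) \<Rightarrow> nat \<Rightarrow> int \<Rightarrow> real" where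
  "torus_kernel p t a k x =
     (\<Sum>\<xi>\<in>{0..<int p}. exp (2 * t * (\<Sum>i<k. cos_mod p (\<xi> * a i))) * cos_mod p (\<xi> * x)) / real p"

lemma torus_kernel_0:
  "p > 0 \<Longrightarrow> torus_kernel p t a 0 x = (if int p dvd x then 1 else 0)"
  by (simp add: torus_kernel_def cos_mod_orthogonality)

text \<open>
  Each further generator convolves the kernel with a Bessel weight along the multiples of that
  generator. Unfolded over all \<open>k\<close> generators, the kernel is the sum of products of Bessel
  functions over a coset of the relation lattice.
\<close>

lemma torus_kernel_Suc:
  assumes t: "t > 0"
  shows "((\<lambda>m. bessel t m * torus_kernel p t a k (x - m * a k)) has_sum torus_kernel p t a (Suc k) x) UNIV"
proof -
  define E where "E k \<xi> = exp (2 * t * (\<Sum>i<k. cos_mod p (\<xi> * a i)))" for k \<xi>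
  have "((\<lambda>m. E k \<xi> * (bessel t m * cos_mod p (\<xi> * (x - m * a k)))) has_sum E (Suc k) \<xi> * cos_mod p (\<xi> * x)) UNIV" for \<xi>
  proof -
    have "((\<lambda>m. E k \<xi> * (bessel t m * cos (2 * pi * real_of_int (\<xi> * x) / real p
              - real_of_int m * (2 * pi * real_of_int (\<xi> * a k) / real p))))
        has_sum E k \<xi> * (exp (2 * t * cos_mod p (\<xi> * a k)) * cos_mod p (\<xi> * x))) UNIV"
      unfolding cos_mod_def by (intro has_sum_cmult_right bessel_fourier t)
    moreover have "2 * pi * real_of_int (\<xi> * x) / real p - real_of_int m * (2 * pi * real_of_int (\<xi> * a k) / real p)
        = 2 * pi * real_of_int (\<xi> * (x - m * a k)) / real p" for m
      by (simp add: algebra_simps diff_divide_distrib)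
    moreover have "E k \<xi> * (exp (2 * t * cos_mod p (\<xi> * a k)) * cos_mod p (\<xi> * x)) = E (Suc k) \<xi> * cos_mod p (\<xi> * x)"
      by (simp add: E_def exp_add[symmetric] algebra_simps)
    ultimately show ?thesis by (simp only: cos_mod_def)
  qed
  then have "((\<lambda>m. (\<Sum>\<xi>\<in>{0..<int p}. E k \<xi> * (bessel t m * cos_mod p (\<xi> * (x - m * a k)))) / real p)
      has_sum (\<Sum>\<xi>\<in>{0..<int p}. E (Suc k) \<xi> * cos_mod p (\<xi> * x)) / real p) UNIV"
    by (intro has_sum_divide_const has_sum_sum_finite) auto
  then show ?thesis
    by (simp add: torus_kernel_def E_def sum_distrib_left mult_ac)
qed

lemma torus_kernel_nonneg:
  assumes "p > 0" "t > 0" shows "torus_kernel p t a k x \<ge> 0"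
proof (induction k arbitrary: x)
  case 0
  then show ?case using assms by (simp add: torus_kernel_0)
next
  case (Suc k)
  show ?case
    using has_sum_nonneg[OF torus_kernel_Suc[OF assms(2)]] Suc bessel_pos[OF assms(2)]
    by (simp add: less_imp_le)
qed

lemma torus_kernel_minus: "torus_kernel p t a k (- x) = torus_kernel p t a k x"
  by (simp add: torus_kernel_def)

lemma torus_kernel_cong:
  assumes p: "p > 0" and xy: "[x = y] (mod int p)"
  shows "torus_kernel p t a k x = torus_kernel p t a k y"
proof -
  have "cos_mod p (\<xi> * x) = cos_mod p (\<xi> * y)" for \<xi>
    by (intro cos_mod_cong p cong_scalar_left xy)
  then show ?thesis by (simp add: torus_kernel_def)
qed

lemma torus_kernel_sum:
  assumes p: "p > 0"
  shows "(\<Sum>x\<in>{0..<int p}. torus_kernel p t a k x) = exp (2 * t * real k)"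
proof -
  let ?E = "\<lambda>\<xi>. exp (2 * t * (\<Sum>i<k. cos_mod p (\<xi> * a i)))"
  have "(\<Sum>x\<in>{0..<int p}. torus_kernel p t a k x)
      = (\<Sum>\<xi>\<in>{0..<int p}. ?E \<xi> * (\<Sum>x\<in>{0..<int p}. cos_mod p (x * \<xi>)) / real p)"
    unfolding torus_kernel_def sum_divide_distrib sum_distrib_left
    by (subst sum.swap) (simp add: mult.commute)
  also have "\<dots> = (\<Sum>\<xi>\<in>{0..<int p}. if \<xi> = 0 then ?E \<xi> else 0)"
    using p by (intro sum.cong) (auto simp: cos_mod_orthogonality zdvd_not_zless)
  also have "\<dots> = exp (2 * t * real k)"
    using p by simp
  finally show ?thesis .
qed

text \<open>
  The reverse log-concavity of the Bessel weights survives convolution: align the two kernels at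
  \<open>x \<plusminus> s\<close> term by term, so that the Bessel arguments become \<open>m + v\<close> and \<open>m - v\<close>, and apply
  Cauchy--Schwarz.
\<close>

lemma torus_kernel_log_curvature:
  assumes p: "p > 0" and t: "t > 1"
  shows "torus_kernel p t a k (x + (\<Sum>i<k. v i * a i)) * torus_kernel p t a k (x - (\<Sum>i<k. v i * a i))
      \<ge> (1 - 1 / t) ^ (\<Sum>i<k. nat ((v i)\<^sup>2)) * (torus_kernel p t a k x)\<^sup>2"
proof (induction k arbitrary: x)
  case 0
  then show ?case by (simp add: power2_eq_square)
next
  case (Suc k)
  define \<kappa> where "\<kappa> = 1 - 1 / t"
  define s where "s = (\<Sum>i<k. v i * a i)"
  define N where "N = (\<Sum>i<k. nat ((v i)\<^sup>2))"
  define M where "M = nat ((v k)\<^sup>2)"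
  define K where "K = torus_kernel p t a k"
  have t0: "t > 0" and \<kappa>: "\<kappa> > 0" using t by (auto simp: \<kappa>_def)
  have K0: "K x \<ge> 0" for x unfolding K_def by (rule torus_kernel_nonneg[OF p t0])
  \<comment> \<open>Moving the base point along the last generator is the same as shifting the Bessel order.\<close>
  have shift: "((\<lambda>m. bessel t (m + c) * K (y - m * a k)) has_sum torus_kernel p t a (Suc k) (y + c * a k)) UNIV" for c y
  proof -
    have "((\<lambda>m. bessel t (m + c) * torus_kernel p t a k (y + c * a k - (m + c) * a k))
        has_sum torus_kernel p t a (Suc k) (y + c * a k)) UNIV"
      using torus_kernel_Suc[OF t0, of p a k "y + c * a k"]
      by (subst has_sum_reindex_bij_betw[where g = "\<lambda>m. m + c" and A = UNIV and B = UNIV])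
         (auto intro!: bij_betwI[where g = "\<lambda>m. m - c"])
    then show ?thesis by (simp add: K_def algebra_simps)
  qed
  have "(sqrt (\<kappa> ^ (N + M)) * torus_kernel p t a (Suc k) x)\<^sup>2
      \<le> torus_kernel p t a (Suc k) (x + s + v k * a k) * torus_kernel p t a (Suc k) (x - s + (- v k) * a k)"
  proof (rule Cauchy_Schwarz_has_sum[OF shift shift])
    show "((\<lambda>m. sqrt (\<kappa> ^ (N + M)) * (bessel t m * K (x - m * a k)))
        has_sum sqrt (\<kappa> ^ (N + M)) * torus_kernel p t a (Suc k) x) UNIV"
      unfolding K_def by (intro has_sum_cmult_right torus_kernel_Suc t0)
    fix m
    show "bessel t (m + v k) * K (x + s - m * a k) \<ge> 0" "bessel t (m + - v k) * K (x - s - m * a k) \<ge> 0"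
      "sqrt (\<kappa> ^ (N + M)) * (bessel t m * K (x - m * a k)) \<ge> 0"
      using K0 bessel_pos[OF t0] \<kappa> by (auto simp: less_imp_le)
    have "(\<kappa> ^ M * (bessel t m)\<^sup>2) * (\<kappa> ^ N * (K (x - m * a k))\<^sup>2)
        \<le> (bessel t (m + v k) * bessel t (m - v k)) * (K (x - m * a k + s) * K (x - m * a k - s))"
    proof (rule mult_mono)
      show "\<kappa> ^ M * (bessel t m)\<^sup>2 \<le> bessel t (m + v k) * bessel t (m - v k)"
        unfolding M_def
        using bessel_curvature[OF t0] bessel_pos[OF t0] \<kappa>
        by (intro ratio_curvature_imp_log_curvature) (auto simp: \<kappa>_def)
      show "\<kappa> ^ N * (K (x - m * a k))\<^sup>2 \<le> K (x - m * a k + s) * K (x - m * a k - s)"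
        using Suc[of "x - m * a k"] by (simp add: K_def N_def s_def \<kappa>_def)
    qed (use bessel_pos[OF t0] \<kappa> in \<open>auto simp: less_imp_le\<close>)
    then show "(sqrt (\<kappa> ^ (N + M)) * (bessel t m * K (x - m * a k)))\<^sup>2
        \<le> (bessel t (m + v k) * K (x + s - m * a k)) * (bessel t (m + - v k) * K (x - s - m * a k))"
      using \<kappa> by (simp add: power_mult_distrib power_add algebra_simps)
  qed
  then show ?case
    using \<kappa> by (simp add: power_mult_distrib N_def M_def s_def \<kappa>_def[symmetric] algebra_simps)
qed

text \<open>
  The left-hand side is \<open>p\<close> times the kernel at \<open>0\<close>. Log-curvature at \<open>0\<close> and evenness bound the
  kernel from below by \<open>exp(-d/t)\<close> times its value at \<open>0\<close> at every residue, and its sum over the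
  residues is the eigenvalue \<open>exp(2tk)\<close> at frequency \<open>0\<close>.
\<close>

lemma torus_heat_trace_bound:
  assumes p: "p > 0" and t: "t \<ge> 2"
    and cover: "\<And>x. \<exists>v. [(\<Sum>i<k. v i * a i) = x] (mod int p) \<and> (\<Sum>i<k. (v i)\<^sup>2) \<le> int d"
  shows "(\<Sum>\<xi>\<in>{0..<int p}. exp (2 * t * (\<Sum>i<k. cos_mod p (\<xi> * a i)))) \<le> exp (real d / t) * exp (2 * t * real k)"
proof -
  let ?K = "torus_kernel p t a k"
  have t0: "t > 0" and t1: "t > 1" using t by auto
  have K0: "?K x \<ge> 0" for x by (rule torus_kernel_nonneg[OF p t0])
  have \<kappa>: "exp (- (2 / t)) \<le> 1 - 1 / t"
  proof -
    have "1 * 1 \<le> (1 + 2 / t) * (1 - 1 / t)"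
      using t by (simp add: field_simps)
    also have "\<dots> \<le> exp (2 / t) * (1 - 1 / t)"
      using t by (intro mult_right_mono exp_ge_add_one_self) auto
    finally show ?thesis by (simp add: exp_minus field_simps)
  qed
  have lower: "exp (- (real d / t)) * ?K 0 \<le> ?K x" for x
  proof -
    obtain v where v: "[(\<Sum>i<k. v i * a i) = x] (mod int p)" and vd: "(\<Sum>i<k. (v i)\<^sup>2) \<le> int d"
      using cover by blast
    have "int (\<Sum>i<k. nat ((v i)\<^sup>2)) \<le> int d"
      using vd by simp
    then have N: "(\<Sum>i<k. nat ((v i)\<^sup>2)) \<le> d"
      by (simp only: of_nat_le_iff)
    have "(exp (- (real d / t)) * ?K 0)\<^sup>2 = exp (- (2 / t)) ^ d * (?K 0)\<^sup>2"
    proof -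
      have "(exp (- (real d / t)))\<^sup>2 = exp (- (2 / t)) ^ d"
        unfolding exp_of_nat_mult[symmetric] by simp
      then show ?thesis by (simp add: power_mult_distrib)
    qed
    also have "\<dots> \<le> (1 - 1 / t) ^ d * (?K 0)\<^sup>2"
      using \<kappa> by (intro mult_right_mono power_mono) auto
    also have "\<dots> \<le> (1 - 1 / t) ^ (\<Sum>i<k. nat ((v i)\<^sup>2)) * (?K 0)\<^sup>2"
      using t by (intro mult_right_mono power_decreasing N) auto
    also have "\<dots> \<le> ?K (\<Sum>i<k. v i * a i) * ?K (- (\<Sum>i<k. v i * a i))"
      using torus_kernel_log_curvature[OF p t1, where x = 0 and k = k and v = v and a = a] by simp
    also have "\<dots> = (?K x)\<^sup>2"
      using torus_kernel_cong[OF p v] by (simp add: torus_kernel_minus power2_eq_square)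
    finally show ?thesis
      by (rule power2_le_imp_le) (rule K0)
  qed
  have "real p * (exp (- (real d / t)) * ?K 0) = (\<Sum>x\<in>{0..<int p}. exp (- (real d / t)) * ?K 0)"
    by simp
  also have "\<dots> \<le> (\<Sum>x\<in>{0..<int p}. ?K x)"
    by (intro sum_mono lower)
  also have "\<dots> = exp (2 * t * real k)"
    by (rule torus_kernel_sum[OF p])
  finally have "real p * ?K 0 \<le> exp (real d / t) * exp (2 * t * real k)"
    by (simp add: exp_minus field_simps)
  then show ?thesis
    using p by (simp add: torus_kernel_def)
qed

section \<open>The spectrum of the random walk\<close>

lemma carrier_Zmod: "carrier (Zmod p) = {0..<int p}"
  by (auto simp: residue_ring_def)

lemma zero_Zmod: "\<zero>\<^bsub>Zmod p\<^esub> = 0"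
  by (simp add: residue_ring_def)

lemma neg_Zmod: "p > 1 \<Longrightarrow> \<ominus>\<^bsub>Zmod p\<^esub> x = (- x) mod int p"
  by (rule residues.res_neg_eq) (auto simp: residues_def)

lemma sym_lazy_gen_setsD:
  assumes "A \<in> sym_lazy_gen_sets p" "p > 1"
  shows "A \<subseteq> {0..<int p}" "0 \<in> A" "finite A" "\<And>y. y \<in> A \<Longrightarrow> (- y) mod int p \<in> A"
proof -
  have *: "A \<subseteq> {0..<int p}" "\<forall>x\<in>{0..<int p}. x \<in> A \<longleftrightarrow> (- x) mod int p \<in> A" "0 \<in> A" "card A > 1"
    using assms unfolding sym_lazy_gen_sets_def carrier_Zmod zero_Zmod neg_Zmod[OF assms(2)] by blast+
  then show "A \<subseteq> {0..<int p}" "0 \<in> A" "\<And>y. y \<in> A \<Longrightarrow> (- y) mod int p \<in> A"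
    by blast+
  show "finite A" using *(4) by (intro card_ge_0_finite) simp
qed

lemma convolution_power_support:
  assumes p: "p > 0"
  shows "set_pmf (convolution_power_Zmod p \<mu> n) \<subseteq> {0..<int p}"
proof (cases n)
  case 0
  then show ?thesis using p by (simp add: zero_Zmod)
next
  case (Suc m)
  have "0 \<le> x \<oplus>\<^bsub>Zmod p\<^esub> y \<and> x \<oplus>\<^bsub>Zmod p\<^esub> y < int p" for x y
    using p by (simp add: residue_ring_def)
  then show ?thesis
    unfolding Suc convolution_power_Zmod.simps convolution_Zmod_def set_map_pmf by force
qed

lemma pmf_convolution_uniform:
  assumes p: "p > 0" and A: "finite A" "A \<noteq> {}"
    and \<nu>: "set_pmf \<nu> \<subseteq> {0..<int p}" and x: "x \<in> {0..<int p}"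
  shows "pmf (convolution_Zmod p (pmf_of_set A) \<nu>) x
      = (\<Sum>y\<in>A. pmf \<nu> ((x - y) mod int p)) / real (card A)"
proof -
  have "convolution_Zmod p (pmf_of_set A) \<nu> = bind_pmf (pmf_of_set A) (\<lambda>y. map_pmf (\<lambda>z. (y + z) mod int p) \<nu>)"
    unfolding convolution_Zmod_def pair_pmf_def map_pmf_def bind_assoc_pmf bind_return_pmf
    by (simp add: residue_ring_def)
  moreover have "pmf (map_pmf (\<lambda>z. (y + z) mod int p) \<nu>) x = pmf \<nu> ((x - y) mod int p)" for y
  proof -
    have "z \<in> (\<lambda>z. (y + z) mod int p) -` {x} \<longleftrightarrow> z \<in> {(x - y) mod int p}" if "z \<in> set_pmf \<nu>" for z
    proof -
      have "z \<in> {0..<int p}" using that \<nu> by auto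
      then have "z mod int p = z" and "x mod int p = x" using x by auto
      moreover have "(y + z) mod int p = x mod int p \<longleftrightarrow> z mod int p = (x - y) mod int p"
        unfolding mod_eq_dvd_iff by (simp add: algebra_simps)
      ultimately show ?thesis by (simp only: vimage_def mem_Collect_eq singleton_iff)
    qed
    then have "(\<lambda>z. (y + z) mod int p) -` {x} \<inter> set_pmf \<nu> = {(x - y) mod int p} \<inter> set_pmf \<nu>"
      by blast
    then have "measure_pmf.prob \<nu> ((\<lambda>z. (y + z) mod int p) -` {x}) = measure_pmf.prob \<nu> {(x - y) mod int p}"
      by (subst (1 2) measure_Int_set_pmf[symmetric]) simp
    then show ?thesis
      by (simp only: pmf_map measure_pmf_single)
  qed
  ultimately show ?thesis
    using A by (simp add: pmf_bind_pmf_of_set)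
qed

definition walk_eigenvalue :: "nat \<Rightarrow> int set \<Rightarrow> int \<Rightarrow> real" where
  "walk_eigenvalue p A \<xi> = (\<Sum>y\<in>A. cos_mod p (\<xi> * y)) / real (card A)"

text \<open>
  Fourier inversion for the walk. The symmetry of \<open>A\<close> removes the sine terms, so the cosines are
  eigenfunctions.
\<close>

lemma pmf_convolution_power:
  assumes p: "p > 0" and A: "finite A" "A \<noteq> {}" "A \<subseteq> {0..<int p}"
    and sym: "\<And>y. y \<in> A \<Longrightarrow> (- y) mod int p \<in> A"
    and x: "x \<in> {0..<int p}"
  shows "pmf (convolution_power_Zmod p (pmf_of_set A) n) x
      = (\<Sum>\<xi>\<in>{0..<int p}. walk_eigenvalue p A \<xi> ^ n * cos_mod p (\<xi> * x)) / real p"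
  using x
proof (induction n arbitrary: x)
  case 0
  then have "int p dvd x \<longleftrightarrow> x = 0"
    by (auto dest: zdvd_imp_le)
  then show ?case
    using p by (simp add: zero_Zmod cos_mod_orthogonality indicator_def)
next
  case (Suc n)
  let ?I = "{0..<int p}" and ?l = "walk_eigenvalue p A"
  have eig: "(\<Sum>y\<in>A. cos_mod p (\<xi> * (x - y))) = real (card A) * ?l \<xi> * cos_mod p (\<xi> * x)" for \<xi>
  proof -
    have "(\<Sum>y\<in>A. cos_mod p (\<xi> * (x - y))) = (\<Sum>y\<in>A. cos_mod p (\<xi> * (x + y)))"
    proof (rule sum.reindex_bij_witness[of _ "\<lambda>y. (- y) mod int p" "\<lambda>y. (- y) mod int p"])
      fix y assume y: "y \<in> A"
      then have "(- ((- y) mod int p)) mod int p = y mod int p"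
        by (simp add: mod_minus_eq)
      then show "(- ((- y) mod int p)) mod int p = y" "(- ((- y) mod int p)) mod int p = y"
        using y A(3) by auto
      show "(- y) mod int p \<in> A" "(- y) mod int p \<in> A" by (rule sym[OF y])+
      show "cos_mod p (\<xi> * (x + (- y) mod int p)) = cos_mod p (\<xi> * (x - y))"
        using mod_add_right_eq[of x "- y" "int p"]
        by (intro cos_mod_cong[OF p] cong_scalar_left) (simp add: Cong.cong_def)
    qed
    then have "2 * (\<Sum>y\<in>A. cos_mod p (\<xi> * (x - y)))
        = (\<Sum>y\<in>A. cos_mod p (\<xi> * (x - y)) + cos_mod p (\<xi> * (x + y)))"
      by (simp add: sum.distrib)
    also have "\<dots> = (\<Sum>y\<in>A. 2 * (cos_mod p (\<xi> * x) * cos_mod p (\<xi> * y)))"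
      by (intro sum.cong refl) (simp add: cos_mod_mult right_diff_distrib distrib_left)
    also have "\<dots> = 2 * (real (card A) * ?l \<xi> * cos_mod p (\<xi> * x))"
    proof -
      have "real (card A) * ?l \<xi> = (\<Sum>y\<in>A. cos_mod p (\<xi> * y))"
        using A(1,2) by (simp add: walk_eigenvalue_def)
      then show ?thesis by (simp add: sum_distrib_left sum_distrib_right mult_ac)
    qed
    finally show ?thesis by simp
  qed
  have "pmf (convolution_power_Zmod p (pmf_of_set A) (Suc n)) x
      = (\<Sum>y\<in>A. pmf (convolution_power_Zmod p (pmf_of_set A) n) ((x - y) mod int p)) / real (card A)"
    using pmf_convolution_uniform[OF p A(1,2) convolution_power_support[OF p] Suc.prems] by simp
  also have "\<dots> = (\<Sum>y\<in>A. (\<Sum>\<xi>\<in>?I. ?l \<xi> ^ n * cos_mod p (\<xi> * (x - y))) / real p) / real (card A)"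
  proof -
    have "cos_mod p (\<xi> * ((x - y) mod int p)) = cos_mod p (\<xi> * (x - y))" for \<xi> y
      by (intro cos_mod_cong[OF p] cong_scalar_left) (simp add: Cong.cong_def)
    then show ?thesis using p by (simp add: Suc.IH)
  qed
  also have "\<dots> = (\<Sum>y\<in>A. \<Sum>\<xi>\<in>?I. ?l \<xi> ^ n * cos_mod p (\<xi> * (x - y))) / (real p * real (card A))"
    by (simp add: sum_divide_distrib)
  also have "(\<Sum>y\<in>A. \<Sum>\<xi>\<in>?I. ?l \<xi> ^ n * cos_mod p (\<xi> * (x - y)))
      = (\<Sum>\<xi>\<in>?I. ?l \<xi> ^ n * (\<Sum>y\<in>A. cos_mod p (\<xi> * (x - y))))"
    by (subst sum.swap) (simp add: sum_distrib_left)
  also have "\<dots> = real (card A) * (\<Sum>\<xi>\<in>?I. ?l \<xi> ^ Suc n * cos_mod p (\<xi> * x))"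
    unfolding eig sum_distrib_left by (intro sum.cong refl) simp
  finally show ?case using A(1,2) by simp
qed

text \<open>
  Cauchy--Schwarz against the uniform measure; the radicand is the \<open>\<chi>\<^sup>2\<close> distance to uniform.
\<close>

lemma tv_dist_uniform_le:
  assumes p: "p > 0" and \<mu>: "set_pmf \<mu> \<subseteq> {0..<int p}"
  shows "tv_dist \<mu> (pmf_of_set {0..<int p}) \<le> sqrt (real p * (\<Sum>x\<in>{0..<int p}. (pmf \<mu> x)\<^sup>2) - 1)"
proof -
  let ?I = "{0..<int p}"
  have total: "(\<Sum>x\<in>?I. pmf \<mu> x) = 1"
    using \<mu> by (intro sum_pmf_eq_1) auto
  have "(\<Sum>x\<in>?I. \<bar>pmf \<mu> x - 1 / real p\<bar>)\<^sup>2 \<le> (\<Sum>x\<in>?I. \<bar>pmf \<mu> x - 1 / real p\<bar>\<^sup>2) * real (card ?I)"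
    by (rule sum_squared_le_sum_of_squares)
  also have "(\<Sum>x\<in>?I. \<bar>pmf \<mu> x - 1 / real p\<bar>\<^sup>2) = (\<Sum>x\<in>?I. (pmf \<mu> x)\<^sup>2 - 2 / real p * pmf \<mu> x + (1 / real p)\<^sup>2)"
    by (intro sum.cong refl) (simp add: power2_diff)
  also have "\<dots> = (\<Sum>x\<in>?I. (pmf \<mu> x)\<^sup>2) - 1 / real p"
  proof -
    have "(\<Sum>x\<in>?I. 2 / real p * pmf \<mu> x) = 2 / real p"
      unfolding sum_distrib_left[symmetric] total by simp
    then show ?thesis
      unfolding sum.distrib sum_subtractf using p by (simp add: power2_eq_square)
  qed
  finally have sq: "(\<Sum>x\<in>?I. \<bar>pmf \<mu> x - 1 / real p\<bar>)\<^sup>2 \<le> real p * (\<Sum>x\<in>?I. (pmf \<mu> x)\<^sup>2) - 1"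
    using p by (simp add: algebra_simps)
  have "\<bar>measure_pmf.prob \<mu> S - measure_pmf.prob (pmf_of_set ?I) S\<bar>
      \<le> sqrt (real p * (\<Sum>x\<in>?I. (pmf \<mu> x)\<^sup>2) - 1)" for S
  proof -
    have on_I: "measure_pmf.prob \<nu> S = (\<Sum>x\<in>S \<inter> ?I. pmf \<nu> x)" if "set_pmf \<nu> \<subseteq> ?I" for \<nu>
    proof -
      have "measure_pmf.prob \<nu> S = measure_pmf.prob \<nu> (S \<inter> ?I)"
        using that by (intro measure_prob_cong_0) (auto simp: set_pmf_iff)
      then show ?thesis by (simp add: measure_measure_pmf_finite)
    qed
    have "measure_pmf.prob \<mu> S - measure_pmf.prob (pmf_of_set ?I) S = (\<Sum>x\<in>S \<inter> ?I. pmf \<mu> x - 1 / real p)"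
      using p by (simp add: on_I \<mu> sum_subtractf)
    also have "\<bar>\<dots>\<bar> \<le> (\<Sum>x\<in>S \<inter> ?I. \<bar>pmf \<mu> x - 1 / real p\<bar>)"
      by (rule sum_abs)
    also have "\<dots> \<le> (\<Sum>x\<in>?I. \<bar>pmf \<mu> x - 1 / real p\<bar>)"
      by (intro sum_mono2) auto
    also have "\<dots> \<le> sqrt (real p * (\<Sum>x\<in>?I. (pmf \<mu> x)\<^sup>2) - 1)"
      by (intro real_le_rsqrt sq)
    finally show ?thesis .
  qed
  then show ?thesis
    unfolding tv_dist_def by (intro cSUP_least) auto
qed

lemma walk_eigenvalue_cong:
  "p > 0 \<Longrightarrow> [\<xi> = \<eta>] (mod int p) \<Longrightarrow> walk_eigenvalue p A \<xi> = walk_eigenvalue p A \<eta>"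
  unfolding walk_eigenvalue_def
  by (intro arg_cong2[where f = "(/)"] sum.cong refl cos_mod_cong cong_scalar_right)

lemma tv_dist_convolution_power_le:
  assumes p: "p > 1" and A: "A \<in> sym_lazy_gen_sets p"
  shows "tv_dist (convolution_power_Zmod p (pmf_of_set A) n) (pmf_of_set (carrier (Zmod p)))
      \<le> sqrt ((\<Sum>\<xi>\<in>{0..<int p}. walk_eigenvalue p A \<xi> ^ (2 * n)) - 1)"
proof -
  note AD = sym_lazy_gen_setsD[OF A p]
  have p0: "p > 0" using p by simp
  have "(\<Sum>x\<in>{0..<int p}. (pmf (convolution_power_Zmod p (pmf_of_set A) n) x)\<^sup>2)
      = (\<Sum>\<xi>\<in>{0..<int p}. (walk_eigenvalue p A \<xi> ^ n)\<^sup>2) / real p"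
  proof (rule even_parseval[OF p0])
    show "walk_eigenvalue p A \<xi> ^ n = walk_eigenvalue p A \<eta> ^ n" if "[\<xi> = \<eta>] (mod int p)" for \<xi> \<eta>
      using walk_eigenvalue_cong[OF p0 that] by simp
    show "walk_eigenvalue p A (- \<xi>) ^ n = walk_eigenvalue p A \<xi> ^ n" for \<xi>
      by (simp add: walk_eigenvalue_def)
  next
    fix x assume "x \<in> {0..<int p}"
    then show "pmf (convolution_power_Zmod p (pmf_of_set A) n) x
        = (\<Sum>\<xi>\<in>{0..<int p}. walk_eigenvalue p A \<xi> ^ n * cos_mod p (\<xi> * x)) / real p"
      using AD by (intro pmf_convolution_power p0) auto
  qed
  then show ?thesis
    using tv_dist_uniform_le[OF p0 convolution_power_support[OF p0, of "pmf_of_set A" n]] p0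
    by (simp add: carrier_Zmod power_mult[symmetric] mult.commute)
qed

text \<open>
  The nonzero elements of \<open>A\<close> split into the pairs \<open>{a\<^sub>i, -a\<^sub>i}\<close>; oddness of \<open>p\<close> makes the two members
  of a pair distinct, and the uniqueness of representatives makes the pairs disjoint.
\<close>

lemma walk_eigenvalue_representatives:
  assumes p: "odd p" "p > 1" and A: "A \<in> sym_lazy_gen_sets p" and card: "card A = 2 * k + 1"
    and rep: "representative_vector p A k a"
  shows "walk_eigenvalue p A \<xi> = (1 + 2 * (\<Sum>i<k. cos_mod p (\<xi> * a i))) / (2 * real k + 1)"
proof -
  note AD = sym_lazy_gen_setsD[OF A p(2)]
  have p0: "p > 0" using p by simp
  define N where "N x = (- x) mod int p" for x :: int
  have aA: "a i \<in> A" "a i \<noteq> 0" if "i < k" for i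
    using rep that unfolding representative_vector_def zero_Zmod by auto
  have uniq: "\<exists>!i. i < k \<and> a i \<in> {x, N x}" if "x \<in> A" "x \<noteq> 0" for x
    using rep that unfolding representative_vector_def zero_Zmod neg_Zmod[OF p(2)] N_def by auto
  have N: "N x = int p - x" "N x \<in> A" "N x \<noteq> 0" "N x \<noteq> x" if "x \<in> A" "x \<noteq> 0" for x
  proof -
    have x: "0 < x" "x < int p" using that AD(1) by auto
    then show *: "N x = int p - x" by (simp add: N_def zmod_zminus1_eq_if)
    show "N x \<in> A" unfolding N_def by (rule AD(4)[OF that(1)])
    show "N x \<noteq> 0" using * x by simp
    show "N x \<noteq> x"
    proof
      assume "N x = x"
      then have "int p = 2 * x" using * by simp
      then show False using p(1) by (metis even_of_nat dvd_triv_left)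
    qed
  qed
  have NN: "N (N x) = x" if "x \<in> A" "x \<noteq> 0" for x
    using N[OF that] N(1)[of "N x"] by simp
  have cosN: "cos_mod p (\<xi> * N x) = cos_mod p (\<xi> * x)" for x
  proof -
    have "cos_mod p (\<xi> * N x) = cos_mod p (\<xi> * (- x))"
      unfolding N_def by (intro cos_mod_cong[OF p0] cong_scalar_left) (simp add: Cong.cong_def)
    then show ?thesis by simp
  qed
  have "A - {0} = (\<Union>i\<in>{..<k}. {a i, N (a i)})"
  proof (intro equalityI subsetI)
    fix x assume "x \<in> A - {0}"
    then have x: "x \<in> A" "x \<noteq> 0" by auto
    then obtain i where "i < k" "a i = x \<or> a i = N x" using uniq by blast
    then show "x \<in> (\<Union>i\<in>{..<k}. {a i, N (a i)})" using NN[OF x] by force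
  next
    fix x assume "x \<in> (\<Union>i\<in>{..<k}. {a i, N (a i)})"
    then show "x \<in> A - {0}" using aA N by auto
  qed
  moreover have "(\<Sum>x\<in>(\<Union>i\<in>{..<k}. {a i, N (a i)}). cos_mod p (\<xi> * x))
      = (\<Sum>i<k. \<Sum>x\<in>{a i, N (a i)}. cos_mod p (\<xi> * x))"
  proof (rule sum.UNION_disjoint)
    show "\<forall>i\<in>{..<k}. \<forall>j\<in>{..<k}. i \<noteq> j \<longrightarrow> {a i, N (a i)} \<inter> {a j, N (a j)} = {}"
    proof (intro ballI impI)
      fix i j assume ij: "i \<in> {..<k}" "j \<in> {..<k}" "i \<noteq> j"
      have "a j \<notin> {a i, N (a i)}" "a i \<notin> {a j, N (a j)}"
        using uniq[OF aA, of i] uniq[OF aA, of j] ij by blast+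
      moreover have "N (a i) \<noteq> N (a j)"
        using NN[OF aA, of i] NN[OF aA, of j] \<open>a j \<notin> {a i, N (a i)}\<close> ij by force
      ultimately show "{a i, N (a i)} \<inter> {a j, N (a j)} = {}" by auto
    qed
  qed auto
  moreover have "(\<Sum>x\<in>{a i, N (a i)}. cos_mod p (\<xi> * x)) = 2 * cos_mod p (\<xi> * a i)" if "i < k" for i
    using N(4)[OF aA[OF that]] by (simp add: cosN)
  ultimately have "(\<Sum>x\<in>A - {0}. cos_mod p (\<xi> * x)) = 2 * (\<Sum>i<k. cos_mod p (\<xi> * a i))"
    by (simp add: sum_distrib_left)
  moreover have "(\<Sum>x\<in>A. cos_mod p (\<xi> * x)) = 1 + (\<Sum>x\<in>A - {0}. cos_mod p (\<xi> * x))"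
    using sum.remove[OF AD(3,2), of "\<lambda>x. cos_mod p (\<xi> * x)"] by simp
  ultimately show ?thesis
    by (simp add: walk_eigenvalue_def card)
qed

text \<open>
  The first summand bounds the power when the eigenvalue is nonnegative, by \<open>l \<le> exp(l - 1)\<close>. The second
  does when it is negative: \<open>s \<ge> -k\<close> keeps the eigenvalue at least \<open>2/(2k + 1)\<close> away from \<open>-1\<close>.
\<close>

lemma eigenvalue_power_le:
  fixes s :: real and k n :: nat
  assumes s: "- real k \<le> s" and t: "t = 2 * real n / (2 * real k + 1)"
  shows "((1 + 2 * s) / (2 * real k + 1)) ^ (2 * n) \<le> exp (2 * t * s) * exp (- (2 * t * real k)) + exp (- (2 * t))"
proof -
  define l where "l = (1 + 2 * s) / (2 * real k + 1)"
  define q where "q = 2 * real k + 1"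
  have q: "q > 0" by (simp add: q_def)
  show ?thesis
  proof (cases "l \<ge> 0")
    case True
    have "l \<le> exp (l - 1)" using exp_ge_add_one_self[of "l - 1"] by simp
    then have "l ^ (2 * n) \<le> exp (l - 1) ^ (2 * n)" using True by (intro power_mono)
    also have "\<dots> = exp (real (2 * n) * (l - 1))" by (rule exp_of_nat_mult[symmetric])
    also have "real (2 * n) * (l - 1) = 2 * t * s - 2 * t * real k"
    proof -
      have "l - 1 = (2 * s - 2 * real k) / q"
        using q by (simp add: l_def q_def field_simps)
      moreover have "t = 2 * real n / q" by (simp add: t q_def)
      ultimately show ?thesis by (simp only:) (simp add: diff_divide_distrib algebra_simps)
    qed
    also have "exp (2 * t * s - 2 * t * real k) = exp (2 * t * s) * exp (- (2 * t * real k))"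
      by (simp add: exp_diff exp_minus divide_inverse)
    finally show ?thesis unfolding l_def by (simp add: add_increasing2)
  next
    case False
    have "- l \<le> 1 + - 2 / q"
    proof -
      have "- l = (- 1 - 2 * s) / q" by (simp add: l_def q_def minus_divide_left)
      also have "\<dots> \<le> (q - 2) / q" using s q by (intro divide_right_mono) (auto simp: q_def)
      also have "\<dots> = 1 + - 2 / q" using q by (simp add: diff_divide_distrib)
      finally show ?thesis .
    qed
    also have "\<dots> \<le> exp (- 2 / q)" by (rule exp_ge_add_one_self)
    finally have "(- l) ^ (2 * n) \<le> exp (- 2 / q) ^ (2 * n)" using False by (intro power_mono) auto
    also have "\<dots> = exp (real (2 * n) * (- 2 / q))" by (rule exp_of_nat_mult[symmetric])
    also have "real (2 * n) * (- 2 / q) = - (2 * t)"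
      by (simp add: t q_def[symmetric])
    finally show ?thesis unfolding l_def[symmetric] by (simp add: add_increasing)
  qed
qed

lemma cos_mod_ge: "cos_mod p x \<ge> -1"
  by (simp add: cos_mod_def)

lemma sum_eigenvalue_powers_le:
  assumes p: "odd p" "p > 1" and A: "A \<in> sym_lazy_gen_sets p" and card: "card A = 2 * k + 1"
    and rep: "representative_vector p A k a"
    and t: "t = 2 * real n / (2 * real k + 1)" "t \<ge> 2"
    and cover: "\<And>x. \<exists>v. [(\<Sum>i<k. v i * a i) = x] (mod int p) \<and> (\<Sum>i<k. (v i)\<^sup>2) \<le> int d"
  shows "(\<Sum>\<xi>\<in>{0..<int p}. walk_eigenvalue p A \<xi> ^ (2 * n)) \<le> exp (real d / t) + real p * exp (- (2 * t))"
proof -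
  have p0: "p > 0" using p by simp
  let ?s = "\<lambda>\<xi>. \<Sum>i<k. cos_mod p (\<xi> * a i)"
  have s: "- real k \<le> ?s \<xi>" for \<xi>
  proof -
    have "(\<Sum>i<k. -1 :: real) \<le> ?s \<xi>" by (intro sum_mono cos_mod_ge)
    then show ?thesis by simp
  qed
  have "(\<Sum>\<xi>\<in>{0..<int p}. walk_eigenvalue p A \<xi> ^ (2 * n))
      \<le> (\<Sum>\<xi>\<in>{0..<int p}. exp (2 * t * ?s \<xi>) * exp (- (2 * t * real k)) + exp (- (2 * t)))"
    unfolding walk_eigenvalue_representatives[OF p A card rep]
    by (intro sum_mono eigenvalue_power_le s t(1))
  also have "\<dots> = (\<Sum>\<xi>\<in>{0..<int p}. exp (2 * t * ?s \<xi>)) * exp (- (2 * t * real k)) + real p * exp (- (2 * t))"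
    by (simp add: sum.distrib sum_distrib_right)
  also have "\<dots> \<le> exp (real d / t) * exp (2 * t * real k) * exp (- (2 * t * real k)) + real p * exp (- (2 * t))"
    using torus_heat_trace_bound[OF p0 t(2) cover] by (intro add_right_mono mult_right_mono) auto
  also have "exp (real d / t) * exp (2 * t * real k) * exp (- (2 * t * real k)) = exp (real d / t)"
    by (simp add: mult.assoc exp_add[symmetric] del: exp_add)
  finally show ?thesis .
qed

section \<open>The geometric diameter\<close>

text \<open>
  The diameter is the length of an integer vector, so its square is an integer; it is positive because
  the zero vector does not represent the residue \<open>1\<close>.
\<close>

lemma diam_geom_covering:
  assumes p: "prime p" and k: "k \<ge> 1" and A: "A \<in> sym_lazy_gen_sets p"
    and rep: "representative_vector p A k a"
  obtains d where "(diam_geom p k a)\<^sup>2 = real d" "d \<ge> 1"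
    "\<And>x. \<exists>v. [(\<Sum>i<k. v i * a i) = x] (mod int p) \<and> (\<Sum>i<k. (v i)\<^sup>2) \<le> int d"
proof -
  have p1: "p > 1" using p by (rule prime_gt_1_nat)
  have "a 0 \<in> A - {0}"
    using rep k unfolding representative_vector_def zero_Zmod by auto
  then have "0 < a 0" "a 0 < int p"
    using sym_lazy_gen_setsD(1)[OF A p1] by auto
  then have "\<not> int p dvd a 0" by (rule zdvd_not_zless)
  then have att: "Inf (rep_lengths p k a x) \<in> rep_lengths p k a x" for x
    using Inf_rep_lengths_attained[OF p, of 0 k a x] k by simp
  have L2: "(L2_set (\<lambda>i. real_of_int (v i)) {..<k})\<^sup>2 = real_of_int (\<Sum>i<k. (v i)\<^sup>2)" for v
    by (simp add: L2_set_def sum_nonneg)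
  let ?R = "(\<lambda>x. Inf (rep_lengths p k a x)) ` carrier (Zmod p)"
  have fin: "finite ?R" "?R \<noteq> {}" using p1 by (auto simp: carrier_Zmod)
  have "diam_geom p k a \<in> ?R"
    unfolding diam_geom_def by (rule Max_in[OF fin])
  then obtain x0 where "diam_geom p k a = Inf (rep_lengths p k a x0)" by blast
  then have "diam_geom p k a \<in> rep_lengths p k a x0" using att[of x0] by simp
  then obtain v0 where v0: "diam_geom p k a = L2_set (\<lambda>i. real_of_int (v0 i)) {..<k}"
    unfolding rep_lengths_def by blast
  define d where "d = nat (\<Sum>i<k. (v0 i)\<^sup>2)"
  have d: "(diam_geom p k a)\<^sup>2 = real d"
    unfolding v0 L2 d_def by (simp add: sum_nonneg)
  have cover: "\<exists>v. [(\<Sum>i<k. v i * a i) = x] (mod int p) \<and> (\<Sum>i<k. (v i)\<^sup>2) \<le> int d" for x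
  proof -
    define y where "y = x mod int p"
    obtain v where v: "Inf (rep_lengths p k a y) = L2_set (\<lambda>i. real_of_int (v i)) {..<k}"
      "[(\<Sum>i<k. v i * a i) = y] (mod int p)"
      using att[of y] unfolding rep_lengths_def by auto
    have "Inf (rep_lengths p k a y) \<le> diam_geom p k a"
      unfolding diam_geom_def using p1 fin by (intro Max_ge) (auto simp: y_def carrier_Zmod)
    then have "(L2_set (\<lambda>i. real_of_int (v i)) {..<k})\<^sup>2 \<le> (diam_geom p k a)\<^sup>2"
      unfolding v(1) by (intro power_mono L2_set_nonneg)
    then have "real_of_int (\<Sum>i<k. (v i)\<^sup>2) \<le> real_of_int (int d)"
      unfolding L2 d by simp
    then have "(\<Sum>i<k. (v i)\<^sup>2) \<le> int d"
      by (simp only: of_int_le_iff)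
    moreover have "[(\<Sum>i<k. v i * a i) = x] (mod int p)"
      using v(2) by (simp add: y_def Cong.cong_def)
    ultimately show ?thesis by blast
  qed
  have "d \<noteq> 0"
  proof
    assume "d = 0"
    then obtain v where v: "[(\<Sum>i<k. v i * a i) = 1] (mod int p)" "(\<Sum>i<k. (v i)\<^sup>2) \<le> 0"
      using cover[of 1] by auto
    have "(\<Sum>i<k. (v i)\<^sup>2) = 0" using v(2) by (intro antisym sum_nonneg) auto
    then have "v i = 0" if "i < k" for i
      using that by (simp add: sum_nonneg_eq_0_iff)
    then have "(\<Sum>i<k. v i * a i) = 0" by simp
    then show False using v(1) p1 by (simp add: Cong.cong_def)
  qed
  then show thesis using that[OF d _ cover] by simp
qed

text \<open>
  Coordinates of a vector of length at most \<open>\<surd>d\<close> lie in \<open>[-\<surd>d, \<surd>d]\<close>, so the residues are covered by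
  the image of a box.
\<close>

lemma card_le_of_covering:
  assumes cover: "\<And>x. \<exists>v. [(\<Sum>i<k. v i * a i) = x] (mod int p) \<and> (\<Sum>i<k. (v i)\<^sup>2) \<le> int d"
  shows "real p \<le> (2 * sqrt (real d) + 1) ^ k"
proof -
  define m where "m = nat \<lfloor>sqrt (real d)\<rfloor>"
  have m: "real m \<le> sqrt (real d)" by (simp add: m_def)
  let ?B = "PiE {..<k} (\<lambda>_. {- int m..int m})"
  have "{0..<int p} \<subseteq> (\<lambda>v. (\<Sum>i<k. v i * a i) mod int p) ` ?B"
  proof
    fix x assume x: "x \<in> {0..<int p}"
    obtain v where v: "[(\<Sum>i<k. v i * a i) = x] (mod int p)" "(\<Sum>i<k. (v i)\<^sup>2) \<le> int d"
      using cover by blast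
    have "\<bar>v i\<bar> \<le> int m" if "i < k" for i
    proof -
      have "(v i)\<^sup>2 \<le> (\<Sum>i<k. (v i)\<^sup>2)" using that by (intro member_le_sum) auto
      then have "(v i)\<^sup>2 \<le> int d" using v(2) by linarith
      then have "real_of_int ((v i)\<^sup>2) \<le> real_of_int (int d)" by (simp only: of_int_le_iff)
      then have "\<bar>real_of_int (v i)\<bar> \<le> sqrt (real d)" by (intro real_le_rsqrt) simp
      then have "\<bar>v i\<bar> \<le> \<lfloor>sqrt (real d)\<rfloor>" by (simp add: le_floor_iff)
      then show ?thesis by (simp add: m_def)
    qed
    then have "restrict v {..<k} \<in> ?B" by (simp add: restrict_PiE_iff abs_le_iff minus_le_iff)
    moreover have "x = (\<Sum>i<k. restrict v {..<k} i * a i) mod int p"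
    proof -
      have "x mod int p = x" using x by simp
      moreover have "(\<Sum>i<k. restrict v {..<k} i * a i) = (\<Sum>i<k. v i * a i)"
        by (intro sum.cong) auto
      ultimately show ?thesis using v(1) unfolding Cong.cong_def by metis
    qed
    ultimately show "x \<in> (\<lambda>v. (\<Sum>i<k. v i * a i) mod int p) ` ?B" by blast
  qed
  then have "card {0..<int p} \<le> card ?B"
    by (intro surj_card_le) (auto intro: finite_PiE)
  then have "p \<le> (2 * m + 1) ^ k"
  proof -
    have "card {- int m..int m} = 2 * m + 1" by simp
    then show ?thesis using \<open>card {0..<int p} \<le> card ?B\<close> by (simp only: card_PiE finite_lessThan prod_constant card_lessThan) simp
  qed
  then have "real p \<le> real ((2 * m + 1) ^ k)"
    by (simp only: of_nat_le_iff)
  then have "real p \<le> (2 * real m + 1) ^ k"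
    by (simp add: add.commute)
  also have "\<dots> \<le> (2 * sqrt (real d) + 1) ^ k"
    using m by (intro power_mono) auto
  finally show ?thesis .
qed

section \<open>The mixing time\<close>

theorem theorem2:
  shows "\<exists>C::real. C > 0 \<and>
    (\<forall>(p::nat) (k::nat) (A::int set) (a::nat \<Rightarrow> int).
       prime p \<longrightarrow> odd p \<longrightarrow> 1 \<le> k \<longrightarrow> real k \<le> ln (real p) / ln (ln (real p)) \<longrightarrow>
       A \<in> sym_lazy_gen_sets p \<longrightarrow> card A = 2 * k + 1 \<longrightarrow>
       representative_vector p A k a \<longrightarrow>
       ereal_of_enat (mixing_time p A) \<le> ereal (C * real k * (diam_geom p k a)\<^sup>2))"
proof (intro exI[of _ 24] conjI allI impI)
  fix p k :: nat and A :: "int set" and a :: "nat \<Rightarrow> int"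
  assume p: "prime p" "odd p" and k: "1 \<le> k" "real k \<le> ln (real p) / ln (ln (real p))"
    and A: "A \<in> sym_lazy_gen_sets p" and card: "card A = 2 * k + 1"
    and rep: "representative_vector p A k a"
  have p1: "p > 1" using p(1) by (rule prime_gt_1_nat)
  obtain d where diam: "(diam_geom p k a)\<^sup>2 = real d" and d1: "d \<ge> 1"
    and cover: "\<And>x. \<exists>v. [(\<Sum>i<k. v i * a i) = x] (mod int p) \<and> (\<Sum>i<k. (v i)\<^sup>2) \<le> int d"
    using diam_geom_covering[OF p(1) k(1) A rep] by blast
  have lnp: "ln (real p) > 0" using p1 by simp
  \<comment> \<open>A nonpositive \<open>ln (ln p)\<close> would make the quotient that bounds \<open>k\<close> nonpositive, also with \<open>x / 0 = 0\<close>.\<close>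
  have lnlnp: "ln (ln (real p)) > 0"
  proof (rule ccontr)
    assume "\<not> ln (ln (real p)) > 0"
    then have "ln (real p) / ln (ln (real p)) \<le> 0"
      using lnp by (intro divide_nonneg_nonpos) auto
    then show False using k by simp
  qed
  have "ln (real p) \<le> 2 * sqrt (real d) + 1"
  proof -
    have "real k * ln (ln (real p)) \<le> ln (real p)"
      using k(2) lnlnp by (simp add: pos_le_divide_eq)
    also have "\<dots> \<le> ln ((2 * sqrt (real d) + 1) ^ k)"
      using card_le_of_covering[OF cover] p1 by (intro ln_mono) auto
    also have "\<dots> = real k * ln (2 * sqrt (real d) + 1)"
      by (rule ln_realpow)
    finally have "ln (ln (real p)) \<le> ln (2 * sqrt (real d) + 1)"
      using k(1) by simp
    then show ?thesis
      using lnp by (subst (asm) ln_le_cancel_iff) (auto simp: add_nonneg_pos)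
  qed
  also have "\<dots> \<le> 3 * real d"
  proof -
    have "1 * real d \<le> real d * real d" using d1 by (intro mult_right_mono) auto
    then have "sqrt (real d) \<le> real d" by (intro real_le_lsqrt) (auto simp: power2_eq_square)
    then show ?thesis using d1 by simp
  qed
  finally have "exp (ln (real p)) \<le> exp (3 * real d)" by simp
  then have pd: "real p \<le> exp (3 * real d)" using p1 by simp
  \<comment> \<open>The constant 24 gives \<open>t \<ge> 16 d\<close>, which brings the total variation distance below \<open>1/3 \<le> 1/e\<close>.\<close>
  define n where "n = 24 * k * d"
  define t where "t = 2 * real n / (2 * real k + 1)"
  have t: "t \<ge> 16 * real d"
  proof -
    have "16 * real d * (2 * real k + 1) \<le> 16 * real d * (3 * real k)"
      using k(1) by (intro mult_left_mono) auto
    then show ?thesis by (simp add: t_def n_def pos_le_divide_eq algebra_simps)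
  qed
  have t2: "t \<ge> 2" using t d1 by linarith
  have "(\<Sum>\<xi>\<in>{0..<int p}. walk_eigenvalue p A \<xi> ^ (2 * n)) \<le> exp (real d / t) + real p * exp (- (2 * t))"
    by (rule sum_eigenvalue_powers_le[OF p(2) p1 A card rep t_def t2 cover])
  also have "exp (real d / t) \<le> 1 + 1 / 16 + (1 / 16)\<^sup>2"
  proof -
    have "real d / t \<le> 1 / 16" using t t2 by (simp add: pos_divide_le_eq)
    then have "exp (real d / t) \<le> exp (1 / 16)" by simp
    also have "\<dots> \<le> 1 + 1 / 16 + (1 / 16)\<^sup>2" by (rule exp_bound) auto
    finally show ?thesis .
  qed
  also have "real p * exp (- (2 * t)) \<le> 1 / 30"
  proof -
    have "real p * exp (- (2 * t)) \<le> exp (3 * real d) * exp (- (2 * t))"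
      by (intro mult_right_mono pd) auto
    also have "\<dots> = exp (3 * real d - 2 * t)" by (simp add: exp_add[symmetric])
    also have "\<dots> \<le> exp (- 29)" using t d1 by simp
    also have "\<dots> \<le> 1 / 30" using exp_ge_add_one_self[of 29] by (simp add: exp_minus field_simps)
    finally show ?thesis .
  qed
  finally have sum: "(\<Sum>\<xi>\<in>{0..<int p}. walk_eigenvalue p A \<xi> ^ (2 * n)) - 1 \<le> (1 / 3)\<^sup>2"
    by (simp add: power2_eq_square)
  have "tv_dist (convolution_power_Zmod p (pmf_of_set A) n) (pmf_of_set (carrier (Zmod p))) \<le> sqrt ((1 / 3)\<^sup>2)"
    using tv_dist_convolution_power_le[OF p1 A, of n] real_sqrt_le_mono[OF sum] by linarith
  also have "\<dots> \<le> 1 / exp 1"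
    using exp_le by (simp add: real_sqrt_abs del: power_one_over power_divide)
  finally have "mixing_time p A \<le> enat n"
    unfolding mixing_time_def by (intro Inf_lower) auto
  then have "ereal_of_enat (mixing_time p A) \<le> ereal_of_enat (enat n)"
    by (simp only: ereal_of_enat_le_iff)
  also have "\<dots> = ereal (24 * real k * (diam_geom p k a)\<^sup>2)"
    by (simp add: n_def diam)
  finally show "ereal_of_enat (mixing_time p A) \<le> ereal (24 * real k * (diam_geom p k a)\<^sup>2)" .
qed simp

end
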